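(* Let $K$ be a field, let $n\ge4$, let $\mathcal{C}\neq\mathcal{C}_{n,3}$ be a $3$-uniform clutter on $[n]$, and let $I=I(\bar{\mathcal{C}})\subset S=K[x_1,\dots,x_n]$. Assume that $\{1,2,3\},\{1,2,4\},\{1,3,4\},\{2,3,4\}\in\mathcal{C}$ and that no circuit of $\mathcal{C}$ other than $\{1,2,3\}$ and $\{1,2,4\}$ contains $\{1,2\}$. Let $J=I+(x_1x_2x_3,\,x_1x_2x_4)$. Then $\operatorname{reg}(I)=\operatorname{reg}(J)$.
   Context: $[n]=\{1,\dots,n\}$. A $3$-uniform clutter $\mathcal{C}$ on $[n]$ is a set of $3$-element subsets of $[n]$ (called circuits). $\mathcal{C}_{n,3}$ denotes the set of all $3$-subsets of $[n]$, and the complement of $\mathcal{C}$ is $\bar{\mathcal{C}}=\mathcal{C}_{n,3}\setminus\mathcal{C}$. For a clutter $\mathcal{D}$ on $[n]$, $I(\mathcal{D})=(\prod_{i\in F}x_i : F\in\mathcal{D})\subset S$, and $I(\varnothing)=0$. For a nonzero homogeneous ideal $I\subset S$, $\operatorname{reg}(I)=\sup\{j-i : \beta^S_{i,j}(I)\neq0\}$ is the Castelnuovo-Mumford regularity, where $\beta^S_{i,j}(I)$ are the graded Betti numbers of $I$ as an $S$-module. *)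

theory Defs
  imports "HOL-Library.Poly_Mapping" "HOL-Library.Extended_Real" "HOL-Library.Set_Algebras"
begin

section \<open>Polynomials\<close>

text \<open>
  A polynomial is a finitely supported map from monomials to coefficients, where a monomial is a
  finitely supported exponent function on the indices of the variables. The ring
  $S = K[x_1,\dots,x_n]$ is the set \<open>polys n\<close> of polynomials involving only
  $x_1,\dots,x_n$; the field $K$ is the type \<open>'a\<close>.
\<close>

type_synonym 'a mpoly = "(nat \<Rightarrow>\<^sub>0 nat) \<Rightarrow>\<^sub>0 'a"

definition polys :: "nat \<Rightarrow> 'a::field mpoly set" where
  "polys n = {p. \<forall>m\<in>Poly_Mapping.keys p. Poly_Mapping.keys m \<subseteq> {1..n}}"

definition var :: "nat \<Rightarrow> 'a::field mpoly" where
  "var i = Poly_Mapping.single (Poly_Mapping.single i 1) 1"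

definition mon_deg :: "(nat \<Rightarrow>\<^sub>0 nat) \<Rightarrow> nat" where
  "mon_deg m = (\<Sum>i\<in>Poly_Mapping.keys m. Poly_Mapping.lookup m i)"

definition ideal_gen :: "nat \<Rightarrow> 'a::field mpoly set \<Rightarrow> 'a mpoly set" where
  "ideal_gen n G =
     {(\<Sum>g\<in>A. q g * g) | A q. finite A \<and> A \<subseteq> G \<and> (\<forall>g\<in>A. q g \<in> polys n)}"

section \<open>Minimal graded free resolutions, Betti numbers and regularity\<close>

text \<open>
  A sequence $\cdots \to F_1 \to F_0 \to S$ of graded free $S$-modules of finite rank, given by
  matrices. The module $F_i$ is $\bigoplus_{l < rank\,i} S(-shift\,i\,l)$; its basis element
  number $l$ is sent to the polynomial \<open>aug l\<close> if $i = 0$, and to column $l$ of the matrix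
  \<open>diff (i - 1)\<close> if $i > 0$. So \<open>diff i\<close> describes $F_{i+1} \to F_i$, with
  rows indexed by the basis of $F_i$. Values at indices outside the ranks are irrelevant.
\<close>

record (overloaded) 'a free_complex =
  rank :: "nat \<Rightarrow> nat"
  shift :: "nat \<Rightarrow> nat \<Rightarrow> nat"
  aug :: "nat \<Rightarrow> 'a mpoly"
  diff :: "nat \<Rightarrow> nat \<Rightarrow> nat \<Rightarrow> 'a mpoly"

definition aug_map :: "'a::field free_complex \<Rightarrow> (nat \<Rightarrow> 'a mpoly) \<Rightarrow> 'a mpoly" where
  "aug_map F v = (\<Sum>l<rank F 0. aug F l * v l)"

definition diff_map :: "'a::field free_complex \<Rightarrow> nat \<Rightarrow> (nat \<Rightarrow> 'a mpoly) \<Rightarrow> nat \<Rightarrow> 'a mpoly" where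
  "diff_map F i v k = (\<Sum>l<rank F (Suc i). diff F i k l * v l)"

text \<open>All maps are defined over $S$ and homogeneous of degree $0$ with respect to the shifts.\<close>

definition graded_maps :: "nat \<Rightarrow> 'a::field free_complex \<Rightarrow> bool" where
  "graded_maps n F \<longleftrightarrow>
     (\<forall>l<rank F 0. aug F l \<in> polys n \<and>
        (\<forall>m\<in>Poly_Mapping.keys (aug F l). mon_deg m = shift F 0 l)) \<and>
     (\<forall>i. \<forall>k<rank F i. \<forall>l<rank F (Suc i). diff F i k l \<in> polys n \<and>
        (\<forall>m\<in>Poly_Mapping.keys (diff F i k l). mon_deg m + shift F i k = shift F (Suc i) l))"

text \<open>
  Exactness of $\cdots \to F_1 \to F_0 \to I \to 0$: the image of $F_0$ is $I$, and at each
  $F_i$ the kernel of the outgoing map is the image of the incoming one.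
\<close>

definition resolves :: "nat \<Rightarrow> 'a::field mpoly set \<Rightarrow> 'a free_complex \<Rightarrow> bool" where
  "resolves n I F \<longleftrightarrow>
     {aug_map F v | v. \<forall>l. v l \<in> polys n} = I \<and>
     (\<forall>v. (\<forall>l. v l \<in> polys n) \<longrightarrow>
        (aug_map F v = 0 \<longleftrightarrow>
         (\<exists>w. (\<forall>l. w l \<in> polys n) \<and> (\<forall>k<rank F 0. v k = diff_map F 0 w k)))) \<and>
     (\<forall>i v. (\<forall>l. v l \<in> polys n) \<longrightarrow>
        ((\<forall>k<rank F i. diff_map F i v k = 0) \<longleftrightarrow>
         (\<exists>w. (\<forall>l. w l \<in> polys n) \<and>
              (\<forall>k<rank F (Suc i). v k = diff_map F (Suc i) w k))))"

text \<open>
  Minimality says $\mathrm{im}(F_{i+1} \to F_i) \subseteq \mathfrak{m} F_i$ with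
  $\mathfrak{m} = (x_1,\dots,x_n)$, i.e. no matrix entry has a constant term.
\<close>

definition minimal_graded_free_resolution ::
    "nat \<Rightarrow> 'a::field mpoly set \<Rightarrow> 'a free_complex \<Rightarrow> bool" where
  "minimal_graded_free_resolution n I F \<longleftrightarrow>
     graded_maps n F \<and> resolves n I F \<and>
     (\<forall>i. \<forall>k<rank F i. \<forall>l<rank F (Suc i). Poly_Mapping.lookup (diff F i k l) 0 = 0)"

text \<open>
  The graded Betti number $\beta_{i,j}(I)$ is the number of summands $S(-j)$ of $F_i$ in a minimal
  graded free resolution of the homogeneous ideal $I$. Such a resolution exists and is unique up
  to isomorphism, so the choice of resolution does not matter.
\<close>

definition graded_betti :: "nat \<Rightarrow> 'a::field mpoly set \<Rightarrow> nat \<Rightarrow> nat \<Rightarrow> nat" where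
  "graded_betti n I i j =
     (let F = (SOME F. minimal_graded_free_resolution n I F)
      in card {l. l < rank F i \<and> shift F i l = j})"

definition regularity :: "nat \<Rightarrow> 'a::field mpoly set \<Rightarrow> ereal" where
  "regularity n I = Sup {ereal (real j - real i) | i j. graded_betti n I i j \<noteq> 0}"

section \<open>Clutters\<close>

definition full_clutter :: "nat \<Rightarrow> nat \<Rightarrow> nat set set" where
  "full_clutter n d = {F. F \<subseteq> {1..n} \<and> card F = d}"

definition clutter_complement :: "nat \<Rightarrow> nat \<Rightarrow> nat set set \<Rightarrow> nat set set" where
  "clutter_complement n d C = full_clutter n d - C"

definition circuit_ideal :: "nat \<Rightarrow> nat set set \<Rightarrow> 'a::field mpoly set" where
  "circuit_ideal n D = ideal_gen n ((\<lambda>F. \<Prod>i\<in>F. var i) ` D)"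

end

theory Submission
  imports Defs "HOL-Library.Function_Algebras" "HOL-Library.FuncSet"
begin

text \<open>
  Put $J' = x_1x_2(x_3,\dots,x_n)$. Every $\{1,2,k\}$ with $k \ge 5$ is a non-circuit, so $x_1x_2x_k$
  lies in $I$ and $J = I + J'$. All four triples inside $\{1,2,3,4\}$ are circuits, so every
  generator of $I$ involves some $x_k$ with $k \ge 5$, and $I \cap J' = x_1x_2(x_5,\dots,x_n)$. Up to
  the factor $x_1x_2$, both $J'$ and $I \cap J'$ are generated by variables; hence their resolutions
  are linear, and their $\mathrm{Tor}_i(-,K)$ is concentrated in degree $i+3$. For $d \ge 4$ the
  sequence
  $\mathrm{Tor}_i(I \cap J') \to \mathrm{Tor}_i(I) \oplus \mathrm{Tor}_i(J') \to \mathrm{Tor}_i(J) \to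
  \mathrm{Tor}_{i-1}(I \cap J')$ in degree $i+d$ therefore shows that $\beta_{i,i+d}(I)$ and
  $\beta_{i,i+d}(J)$ vanish together. Both ideals are generated by cubics, so $\beta_{0,3} \ne 0$
  and $\beta_{i,j} = 0$ for $j < i + 3$ in both cases. So the two suprema run over the same set
  of differences $j - i$.

  Betti numbers are defined here by a chosen minimal resolution, and the argument needs a
  functorial description of them. Koszul homology provides it: $\beta_{i,j}(I) \ne 0$ if and only if
  $H_i(x_1,\dots,x_n; I)_j \ne 0$ (\<open>graded_betti_koszul\<close>). Three ingredients give this.

  \<^item> The contraction \<open>koszul_contract\<close>: in a fixed multidegree, dividing the coefficients by one
    variable $x_v$ and wedging with $e_v$ is a contracting homotopy. Applied to a free module it
    shows exactness. Applied to a monomial ideal it works in those multidegrees where the division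
    does not leave the ideal; this covers $J'$ and $I \cap J'$ off the linear strand
    (\<open>pair_koszul_zero\<close>), and squarefree monomial ideals in degrees above $n$
    (\<open>squarefree_koszul_bound\<close>).

  \<^item> Dimension shifting along a minimal cover of a module by a free module (\<open>koszul_shift\<close>,
    \<open>koszul_0_iff\<close>), which reads off the Betti numbers of any minimal resolution.

  \<^item> Existence of a minimal resolution (\<open>minimal_resolution_exists\<close>). Dimension shifting carries
    the vanishing above degree $n$ to every syzygy module. So each of them is generated in degrees
    at most $n$, hence by finitely many elements, because its homogeneous components have finite
    dimension over $K$.
\<close>

(* Exponents of single variables are written with 1 and should not become Suc 0. *)
declare One_nat_def [simp del]

(* Pointwise unfolding is requested explicitly, so that sums of vectors remain sums of vectors. *)
lemmas fun_simps = plus_fun_apply zero_fun_apply minus_apply uminus_apply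

declare fun_simps [simp del]

section \<open>Polynomials\<close>

lemma polys_zero [simp]: "0 \<in> polys n"
  by (simp add: polys_def)

lemma polys_add: "p \<in> polys n \<Longrightarrow> q \<in> polys n \<Longrightarrow> p + q \<in> polys n"
  using keys_add[of p q] by (fastforce simp: polys_def)

lemma keys_uminus [simp]: "Poly_Mapping.keys (- p) = Poly_Mapping.keys (p :: 'b \<Rightarrow>\<^sub>0 'a::ab_group_add)"
  by (auto simp: in_keys_iff)

lemma polys_uminus: "p \<in> polys n \<Longrightarrow> - p \<in> polys n"
  by (simp add: polys_def)

lemma polys_mult: "p \<in> polys n \<Longrightarrow> q \<in> polys n \<Longrightarrow> p * q \<in> polys n"
proof -
  assume a: "p \<in> polys n" "q \<in> polys n"
  have "Poly_Mapping.keys m \<subseteq> {1..n}" if m: "m \<in> Poly_Mapping.keys (p * q)" for m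
  proof -
    obtain b c where "m = b + c" "b \<in> Poly_Mapping.keys p" "c \<in> Poly_Mapping.keys q"
      using keys_mult[of p q] m by auto
    then show ?thesis
      using a keys_add[of b c] by (fastforce simp: polys_def)
  qed
  then show ?thesis by (simp add: polys_def)
qed

lemma polys_sum: "(\<And>i. i \<in> A \<Longrightarrow> f i \<in> polys n) \<Longrightarrow> sum f A \<in> polys n"
  by (induction A rule: infinite_finite_induct) (auto intro: polys_add)

lemma polys_single: "Poly_Mapping.keys m \<subseteq> {1..n} \<Longrightarrow> Poly_Mapping.single m c \<in> polys n"
  by (simp add: polys_def)

lemma polys_const [simp]: "Poly_Mapping.single 0 c \<in> polys n"
  by (simp add: polys_def)

lemma keys_plus_nat:
  "Poly_Mapping.keys (a + b) = Poly_Mapping.keys a \<union> Poly_Mapping.keys (b :: 'b \<Rightarrow>\<^sub>0 nat)"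
  by (auto simp: in_keys_iff lookup_add)

lemma mon_deg_add [simp]: "mon_deg (a + b) = mon_deg a + mon_deg b"
  unfolding mon_deg_def by (rule setsum_keys_plus_distrib) auto

lemma mon_deg_zero [simp]: "mon_deg 0 = 0"
  by (simp add: mon_deg_def)

lemma mon_deg_single [simp]: "mon_deg (Poly_Mapping.single i c) = c"
  by (cases "c = 0") (auto simp: mon_deg_def)

lemma mon_deg_eq_0_iff: "mon_deg m = 0 \<longleftrightarrow> m = 0"
  by (metis finite_keys in_keys_iff mon_deg_def mon_deg_zero poly_mapping_eqI sum_eq_0_iff lookup_zero)

lemma sum_monomials: "(\<Sum>m\<in>Poly_Mapping.keys p. Poly_Mapping.single m (Poly_Mapping.lookup p m)) = p"
proof (rule poly_mapping_eqI)
  fix k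
  have "(\<Sum>m\<in>Poly_Mapping.keys p. Poly_Mapping.lookup (Poly_Mapping.single m (Poly_Mapping.lookup p m)) k)
      = (\<Sum>m\<in>Poly_Mapping.keys p. if m = k then Poly_Mapping.lookup p m else 0)"
    by (intro sum.cong) (auto simp: lookup_single when_def)
  then show "Poly_Mapping.lookup (\<Sum>m\<in>Poly_Mapping.keys p. Poly_Mapping.single m (Poly_Mapping.lookup p m)) k
      = Poly_Mapping.lookup p k"
    by (simp add: lookup_sum in_keys_iff)
qed

text \<open>
  A polynomial is the sum of its terms, so additive statements need to be checked on terms only.
\<close>

lemma poly_induct [case_names zero add single]:
  fixes p :: "'b \<Rightarrow>\<^sub>0 'a::comm_monoid_add"
  assumes "P 0" "\<And>p q. P p \<Longrightarrow> P q \<Longrightarrow> P (p + q)"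
    and "\<And>m. m \<in> Poly_Mapping.keys p \<Longrightarrow> P (Poly_Mapping.single m (Poly_Mapping.lookup p m))"
  shows "P p"
proof -
  have "P (\<Sum>m\<in>A. Poly_Mapping.single m (Poly_Mapping.lookup p m))"
    if "A \<subseteq> Poly_Mapping.keys p" for A
    using that by (induction A rule: infinite_finite_induct) (auto intro: assms)
  then show ?thesis
    by (metis order_refl sum_monomials)
qed

lemma lookup_single_mult:
  fixes p :: "(nat \<Rightarrow>\<^sub>0 nat) \<Rightarrow>\<^sub>0 'a::field"
  shows "Poly_Mapping.lookup (Poly_Mapping.single e c * p) m =
    (if \<exists>m'. m = e + m' then c * Poly_Mapping.lookup p (m - e) else 0)"
proof (induction p rule: poly_induct)
  case zero
  then show ?case by simp
next
  case (add p q)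
  then show ?case by (auto simp: lookup_add algebra_simps)
next
  case (single m')
  have "m - e + e = m" if "m = e + m''" for m'' using that by (simp add: add.commute)
  then show ?case
    by (auto simp: mult_single lookup_single when_def) (metis add.commute)
qed

lemma lookup_var_mult:
  fixes p :: "(nat \<Rightarrow>\<^sub>0 nat) \<Rightarrow>\<^sub>0 'a::field"
  shows "Poly_Mapping.lookup (Poly_Mapping.single (Poly_Mapping.single b 1) c * p) m =
    (if b \<in> Poly_Mapping.keys m then c * Poly_Mapping.lookup p (m - Poly_Mapping.single b 1) else 0)"
proof -
  have "(\<exists>m'. m = Poly_Mapping.single b 1 + m') \<longleftrightarrow> b \<in> Poly_Mapping.keys m"
  proof
    assume "b \<in> Poly_Mapping.keys m"
    then have "m = Poly_Mapping.single b 1 + (m - Poly_Mapping.single b 1)"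
      by (intro poly_mapping_eqI) (auto simp: lookup_add lookup_minus lookup_single when_def in_keys_iff)
    then show "\<exists>m'. m = Poly_Mapping.single b 1 + m'" by blast
  qed (auto simp: keys_plus_nat)
  then show ?thesis by (simp add: lookup_single_mult)
qed

lemma var_plus_minus:
  "b \<in> Poly_Mapping.keys m \<Longrightarrow> m - Poly_Mapping.single b 1 + Poly_Mapping.single b 1 = (m :: nat \<Rightarrow>\<^sub>0 nat)"
  by (intro poly_mapping_eqI) (auto simp: lookup_add lookup_minus lookup_single when_def in_keys_iff)

text \<open>
  The part of a polynomial on the monomials with a given property; with a condition on degrees
  it is a homogeneous component.
\<close>

lift_definition filt :: "('b \<Rightarrow> bool) \<Rightarrow> ('b \<Rightarrow>\<^sub>0 'a::zero) \<Rightarrow> 'b \<Rightarrow>\<^sub>0 'a"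
  is "\<lambda>P f k. if P k then f k else 0"
  by (simp add: Collect_mono_iff rev_finite_subset)

lemma lookup_filt: "Poly_Mapping.lookup (filt P p) k = (if P k then Poly_Mapping.lookup p k else 0)"
  by transfer simp

lemma keys_filt: "Poly_Mapping.keys (filt P p) = {m \<in> Poly_Mapping.keys p. P m}"
  by (auto simp: in_keys_iff lookup_filt split: if_splits)

lemma filt_zero [simp]: "filt P 0 = 0"
  by (rule poly_mapping_eqI) (simp add: lookup_filt)

lemma filt_add: "filt P (p + q) = filt P p + filt P (q :: 'b \<Rightarrow>\<^sub>0 'a::comm_monoid_add)"
  by (rule poly_mapping_eqI) (simp add: lookup_filt lookup_add)

lemma filt_sum: "filt P (sum f A) = (\<Sum>a\<in>A. filt P (f a :: 'b \<Rightarrow>\<^sub>0 'a::comm_monoid_add))"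
  by (induction A rule: infinite_finite_induct) (auto simp: filt_add)

lemma filt_id: "(\<And>m. m \<in> Poly_Mapping.keys p \<Longrightarrow> P m) \<Longrightarrow> filt P p = p"
  by (rule poly_mapping_eqI) (auto simp: lookup_filt in_keys_iff)

lemma filt_polys: "p \<in> polys n \<Longrightarrow> filt P p \<in> polys n"
  by (auto simp: polys_def keys_filt)

lemma filt_single: "filt P (Poly_Mapping.single m c) = (if P m then Poly_Mapping.single m c else 0)"
  by (rule poly_mapping_eqI) (auto simp: lookup_filt lookup_single when_def)

text \<open>
  If multiplication by any term of $p$ turns $Q$ into $P$, taking components commutes with
  multiplication by $p$. Later $p$ is a homogeneous matrix entry, and $P$, $Q$ fix degrees that
  differ by its degree.
\<close>

lemma filt_mult:
  fixes p q :: "'b::comm_monoid_add \<Rightarrow>\<^sub>0 'a::field"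
  assumes "\<And>m m'. m \<in> Poly_Mapping.keys p \<Longrightarrow> P (m + m') \<longleftrightarrow> Q m'"
  shows "filt P (p * q) = p * filt Q q"
proof -
  have "filt P (Poly_Mapping.single m c * q) = Poly_Mapping.single m c * filt Q q"
    if "m \<in> Poly_Mapping.keys p" for m and c :: 'a
    by (induction q rule: poly_induct)
      (auto simp: filt_add distrib_left mult_single filt_single assms[OF that])
  then have "filt P ((\<Sum>m\<in>Poly_Mapping.keys p. Poly_Mapping.single m (Poly_Mapping.lookup p m)) * q)
      = (\<Sum>m\<in>Poly_Mapping.keys p. Poly_Mapping.single m (Poly_Mapping.lookup p m)) * filt Q q"
    by (simp add: sum_distrib_right filt_sum)
  then show ?thesis by (simp add: sum_monomials)
qed

lemma lookup_mult_0:
  fixes p q :: "(nat \<Rightarrow>\<^sub>0 nat) \<Rightarrow>\<^sub>0 'a::field"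
  shows "Poly_Mapping.lookup (p * q) 0 = Poly_Mapping.lookup p 0 * Poly_Mapping.lookup q 0"
proof -
  have *: "(a + b = 0) = (a = 0 \<and> b = 0)" for a b :: "nat \<Rightarrow>\<^sub>0 nat"
    by (auto simp: poly_mapping_eq_iff fun_eq_iff lookup_add)
  have "Poly_Mapping.lookup (Poly_Mapping.single m c * q) 0 = Poly_Mapping.lookup (Poly_Mapping.single m c) 0 * Poly_Mapping.lookup q 0"
    for m c
    by (induction q rule: poly_induct)
      (auto simp: lookup_add algebra_simps mult_single lookup_single when_def *)
  then have "Poly_Mapping.lookup ((\<Sum>m\<in>Poly_Mapping.keys p. Poly_Mapping.single m (Poly_Mapping.lookup p m)) * q) 0
      = Poly_Mapping.lookup (\<Sum>m\<in>Poly_Mapping.keys p. Poly_Mapping.single m (Poly_Mapping.lookup p m)) 0 * Poly_Mapping.lookup q 0"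
    by (simp add: sum_distrib_right lookup_sum)
  then show ?thesis by (simp add: sum_monomials)
qed

section \<open>The Koszul complex\<close>

type_synonym 'a vec = "nat \<Rightarrow> 'a mpoly"

text \<open>
  The exponent of $x_A = \prod_{i \in A} x_i$, and hence the multidegree of the Koszul basis
  element $e_A$: the term $x^m e_A$ has multidegree \<open>m + expo A\<close>.
\<close>

definition expo :: "nat set \<Rightarrow> nat \<Rightarrow>\<^sub>0 nat" where
  "expo A = (\<Sum>i\<in>A. Poly_Mapping.single i 1)"

lemma lookup_expo: "finite A \<Longrightarrow> Poly_Mapping.lookup (expo A) i = (if i \<in> A then 1 else 0)"
  by (simp add: expo_def lookup_sum lookup_single when_def)

lemma keys_expo: "finite A \<Longrightarrow> Poly_Mapping.keys (expo A) = A"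
  by (auto simp: in_keys_iff lookup_expo split: if_splits)

lemma expo_insert: "finite A \<Longrightarrow> b \<notin> A \<Longrightarrow> expo (insert b A) = expo A + Poly_Mapping.single b 1"
  by (simp add: expo_def add.commute)

lemma mon_deg_expo: "finite A \<Longrightarrow> mon_deg (expo A) = card A"
  by (induction A rule: finite_induct) (auto simp: expo_insert, simp add: expo_def)

text \<open>
  The sign that moves $e_b$ to its place in $e_A$, where the indices of $A$ are in increasing order.
\<close>

definition ksign :: "nat \<Rightarrow> nat set \<Rightarrow> 'a::field" where
  "ksign b A = (- 1) ^ card {a \<in> A. a < b}"

lemma ksign_square [simp]: "ksign b A * ksign b A = (1 :: 'a::field)"
  by (simp add: ksign_def flip: power_mult_distrib)

lemma ksign_insert:
  assumes "v \<notin> A"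
  shows "ksign b (insert v A) = (if v < b then - ksign b A else (ksign b A :: 'a::field))"
proof -
  have "{a \<in> insert v A. a < b} = (if v < b then insert v {a \<in> A. a < b} else {a \<in> A. a < b})"
    by auto
  then show ?thesis using assms by (simp add: ksign_def)
qed

text \<open>
  Inserting $b$ and $v$ in the two possible orders gives opposite signs, because exactly one of
  the two insertions has to pass the other index. Both $\partial^2 = 0$ and the homotopy formula
  rest on this.
\<close>

lemma ksign_swap:
  assumes "b \<noteq> v" "b \<notin> A" "v \<notin> A"
  shows "ksign b (insert v A) * ksign v (insert b A) = - (ksign v A * (ksign b A :: 'a::field))"
  using assms by (auto simp: ksign_insert)

text \<open>
  The Koszul differential on $S^r$-valued chains. A chain assigns to $A$ the coefficient of $e_A$;
  so $x_b$ times the coefficient of $e_{A \cup \{b\}}$ contributes to the coefficient of $e_A$.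
\<close>

definition koszul :: "nat \<Rightarrow> (nat set \<Rightarrow> 'a::field vec) \<Rightarrow> nat set \<Rightarrow> 'a vec" where
  "koszul n z A l = (\<Sum>b\<in>{1..n} - A.
     Poly_Mapping.single (Poly_Mapping.single b 1) (ksign b A) * z (insert b A) l)"

lemma koszul_zero: "koszul n 0 = 0"
  by (intro ext) (simp add: fun_simps koszul_def)

lemma koszul_add: "koszul n (z + w) = koszul n z + koszul n w"
  by (intro ext) (simp add: fun_simps koszul_def sum.distrib distrib_left)

lemma koszul_diff: "koszul n (z - w) = koszul n z - koszul n w"
  by (intro ext) (simp add: fun_simps koszul_def sum_subtractf right_diff_distrib)

text \<open>
  The terms cancel in pairs $(b,c)$, $(c,b)$. The diagonal has to be left out, because in
  characteristic $2$ antisymmetry does not make it zero.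
\<close>

lemma sum_antisym:
  fixes g :: "nat \<Rightarrow> nat \<Rightarrow> 'b::ab_group_add"
  assumes "finite B" "\<And>b c. b \<noteq> c \<Longrightarrow> g b c = - g c b"
  shows "(\<Sum>b\<in>B. \<Sum>c\<in>B - {b}. g b c) = 0"
  using assms(1)
proof (induction B rule: finite_induct)
  case empty
  then show ?case by simp
next
  case (insert x B)
  have "(\<Sum>c\<in>insert x B - {b}. g b c) = g b x + (\<Sum>c\<in>B - {b}. g b c)" if "b \<in> B" for b
  proof -
    have "insert x B - {b} = insert x (B - {b})" using that insert by auto
    then show ?thesis using insert by simp
  qed
  moreover have "(\<Sum>c\<in>insert x B - {x}. g x c) = (\<Sum>c\<in>B. - g c x)"
    using insert by (intro sum.cong) (auto intro: assms(2))
  ultimately show ?case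
    using insert by (simp add: sum.distrib sum_negf)
qed

lemma koszul_koszul: "koszul n (koszul n z) = 0"
proof (intro ext)
  fix A l
  define g where "g b c = Poly_Mapping.single (Poly_Mapping.single b 1 + Poly_Mapping.single c 1)
      (ksign b A * ksign c (insert b A)) * z (insert c (insert b A)) l" for b c
  have sw: "ksign b A * ksign c (insert b A) = - (ksign c A * (ksign b (insert c A) :: 'a))"
    if "b \<noteq> c" "b \<notin> A" "c \<notin> A" for b c
    using that by (auto simp: ksign_insert)
  define h where "h b c = (if b \<in> A \<or> c \<in> A then 0 else g b c)" for b c
  have h: "h b c = - h c b" if "b \<noteq> c" for b c
    unfolding h_def g_def using sw[OF that]
    by (auto simp: insert_commute add.commute single_uminus)
  have "koszul n (koszul n z) A l = (\<Sum>b\<in>{1..n} - A. \<Sum>c\<in>{1..n} - A - {b}. g b c)"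
    unfolding koszul_def g_def
    by (auto intro!: sum.cong simp: sum_distrib_left mult_single mult.assoc[symmetric])
  also have "\<dots> = (\<Sum>b\<in>{1..n} - A. \<Sum>c\<in>{1..n} - A - {b}. h b c)"
    by (intro sum.cong) (auto simp: h_def)
  also have "\<dots> = 0"
    by (intro sum_antisym h) auto
  finally show "koszul n (koszul n z) A l = 0 A l" by (simp add: fun_simps)
qed

text \<open>
  Let $c$ choose for each multidegree $u$ one of the variables dividing $x^u$. On the part of
  multidegree $u$ the homotopy $h$ sends $x^m e_A$ to $\pm (x^m / x_v)\, e_v \wedge e_A$ with
  $v = c(u)$, or to $0$ if $v \in A$, and $\partial h + h \partial$ is the identity for $u \neq 0$. So a
  cycle $z$ without constant part in homological degree $0$ is the boundary of $h z$. The second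
  conclusion describes the terms of $h z$. It decides whether $h z$ stays inside a given monomial
  submodule, which depends on $c$.
\<close>

lemma koszul_contract:
  fixes z :: "nat set \<Rightarrow> 'a::field vec"
  assumes cyc: "koszul n z = 0"
    and supp: "\<And>A l m. m \<in> Poly_Mapping.keys (z A l) \<Longrightarrow> A \<subseteq> {1..n} \<and> Poly_Mapping.keys m \<subseteq> {1..n}"
    and const: "\<And>l. Poly_Mapping.lookup (z {} l) 0 = 0"
    and choice: "\<And>u. u \<noteq> 0 \<Longrightarrow> c u \<in> Poly_Mapping.keys u"
  obtains w where "koszul n w = z"
    and "\<And>A l m. m \<in> Poly_Mapping.keys (w A l) \<Longrightarrow> A \<subseteq> {1..n} \<and> c (m + expo A) \<in> A \<and>
      m + Poly_Mapping.single (c (m + expo A)) 1 \<in> Poly_Mapping.keys (z (A - {c (m + expo A)}) l)"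
proof -
  define ok where "ok A m \<longleftrightarrow> A \<subseteq> {1..n} \<and> Poly_Mapping.keys m \<subseteq> {1..n} \<and> c (m + expo A) \<in> A" for A and m
  \<comment> \<open>The coefficients of \<open>h z\<close>.\<close>
  define f where "f A l m = (if ok A m
      then ksign (c (m + expo A)) (A - {c (m + expo A)}) * Poly_Mapping.lookup (z (A - {c (m + expo A)}) l)
          (m + Poly_Mapping.single (c (m + expo A)) 1) else 0)" for A l and m
  have fin: "finite {m. f A l m \<noteq> 0}" for A l
  proof (cases "A \<subseteq> {1..n}")
    case True
    then have "finite A" using finite_subset by blast
    moreover have "{m. f A l m \<noteq> 0} \<subseteq>
        (\<Union>v\<in>A. (\<lambda>m. m + Poly_Mapping.single v 1) -` Poly_Mapping.keys (z (A - {v}) l))"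
      by (auto simp: f_def ok_def in_keys_iff split: if_splits)
    ultimately show ?thesis
      by (elim finite_subset) (auto intro!: finite_vimageI injI)
  qed (simp add: f_def ok_def)
  define w where "w A l = Abs_poly_mapping (f A l)" for A l
  have look: "Poly_Mapping.lookup (w A l) m = f A l m" for A l m
    unfolding w_def using fin by simp
  have "koszul n w = z"
  proof (intro ext poly_mapping_eqI)
    fix A l m
    have L: "Poly_Mapping.lookup (koszul n w A l) m = (\<Sum>b\<in>{1..n} - A.
        if b \<in> Poly_Mapping.keys m then ksign b A * f (insert b A) l (m - Poly_Mapping.single b 1) else 0)"
      unfolding koszul_def by (simp add: lookup_sum lookup_var_mult look cong: if_cong)
    show "Poly_Mapping.lookup (koszul n w A l) m = Poly_Mapping.lookup (z A l) m"
    proof (cases "A \<subseteq> {1..n} \<and> Poly_Mapping.keys m \<subseteq> {1..n}")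
      case False
      have "f (insert b A) l (m - Poly_Mapping.single b 1) = 0" if "b \<in> {1..n}" "b \<in> Poly_Mapping.keys m" for b
      proof (cases "A \<subseteq> {1..n}")
        case True
        with False obtain d where d: "d \<in> Poly_Mapping.keys m" "d \<notin> {1..n}" by blast
        then have "b \<noteq> d" using that by auto
        then have "d \<in> Poly_Mapping.keys (m - Poly_Mapping.single b 1)"
          using d by (auto simp: in_keys_iff lookup_minus lookup_single when_def)
        then show ?thesis using d by (auto simp: f_def ok_def)
      qed (auto simp: f_def ok_def)
      moreover have "Poly_Mapping.lookup (z A l) m = 0"
        using False supp in_keys_iff by metis
      ultimately show ?thesis
        unfolding L by (auto intro!: sum.neutral)
    next
      case True
      then have finA: "finite A" using finite_subset by blast
      show ?thesis
      proof (cases "m + expo A = 0")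
        case u0: True
        then have "m = 0" "A = {}"
          using keys_plus_nat[of m "expo A"] finA by (auto simp: keys_expo)
        then show ?thesis unfolding L using const by simp
      next
        case False
        define v where "v = c (m + expo A)"
        have v: "v \<in> Poly_Mapping.keys m \<union> A"
          using choice[OF False] finA unfolding v_def by (simp add: keys_plus_nat keys_expo)
        have u: "m - Poly_Mapping.single b 1 + expo (insert b A) = m + expo A"
          if "b \<notin> A" "b \<in> Poly_Mapping.keys m" for b
        proof -
          have "m - Poly_Mapping.single b 1 + expo (insert b A) =
              (m - Poly_Mapping.single b 1 + Poly_Mapping.single b 1) + expo A"
            using that finA by (simp add: expo_insert ac_simps)
          then show ?thesis using that var_plus_minus[of b m] by simp
        qed
        have fb: "f (insert b A) l (m - Poly_Mapping.single b 1) =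
            (if v \<in> insert b A then ksign v (insert b A - {v}) * Poly_Mapping.lookup (z (insert b A - {v}) l)
               (m - Poly_Mapping.single b 1 + Poly_Mapping.single v 1) else 0)"
          if "b \<in> {1..n} - A" "b \<in> Poly_Mapping.keys m" for b
        proof -
          have "Poly_Mapping.keys (m - Poly_Mapping.single b 1) \<subseteq> Poly_Mapping.keys m"
            by (auto simp: in_keys_iff lookup_minus)
          then show ?thesis
            using u[of b] that True by (auto simp: f_def ok_def v_def[symmetric])
        qed
        show ?thesis
        proof (cases "v \<in> A")
          case vA: False
          \<comment> \<open>Only the summand \<open>b = v\<close> of the differential survives: it undoes the division by \<open>x_v\<close>.\<close>
          then have vm: "v \<in> Poly_Mapping.keys m" "v \<in> {1..n} - A" using v True by auto
          have "Poly_Mapping.lookup (koszul n w A l) m = (\<Sum>b\<in>{1..n} - A.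
             if b = v then Poly_Mapping.lookup (z A l) m else 0)"
            unfolding L
          proof (intro sum.cong refl)
            fix b assume b: "b \<in> {1..n} - A"
            show "(if b \<in> Poly_Mapping.keys m then ksign b A * f (insert b A) l (m - Poly_Mapping.single b 1) else 0)
              = (if b = v then Poly_Mapping.lookup (z A l) m else 0)"
              using fb[OF b] vm vA b var_plus_minus[of v m]
              by (auto simp: insert_Diff_if mult.assoc[symmetric])
          qed
          then show ?thesis using vm by simp
        next
          case vA: True
          \<comment> \<open>The cycle condition at \<open>A - {v}\<close> isolates the coefficient of \<open>z\<close> at \<open>A\<close>; the other
            summands are those of the differential of \<open>h z\<close>, up to the sign of \<open>ksign_swap\<close>.\<close>
          define B where "B = A - {v}"
          have A: "A = insert v B" "v \<notin> B" using vA by (auto simp: B_def)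
          have rng: "{1..n} - B = insert v ({1..n} - A)" "v \<notin> {1..n} - A"
            using vA True by (auto simp: B_def)
          define t where "t b = (if b \<in> Poly_Mapping.keys m then ksign b B * Poly_Mapping.lookup (z (insert b B) l)
               (m - Poly_Mapping.single b 1 + Poly_Mapping.single v 1) else 0)" for b
          have "Poly_Mapping.lookup (koszul n z B l) (m + Poly_Mapping.single v 1) = 0"
            using cyc by (simp add: fun_simps)
          moreover have "Poly_Mapping.lookup (koszul n z B l) (m + Poly_Mapping.single v 1)
             = ksign v B * Poly_Mapping.lookup (z A l) m + (\<Sum>b\<in>{1..n} - A. t b)"
          proof -
            have "m + Poly_Mapping.single v 1 - Poly_Mapping.single b 1 = m - Poly_Mapping.single b 1 + Poly_Mapping.single v 1"
              if "b \<noteq> v" for b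
              using that by (intro poly_mapping_eqI) (auto simp: lookup_add lookup_minus lookup_single when_def)
            then show ?thesis
              unfolding koszul_def rng(1) using rng(2)
              by (simp add: lookup_add lookup_sum lookup_var_mult keys_plus_nat A(1)[symmetric])
                 (intro sum.cong, auto simp: t_def A)
          qed
          moreover have "Poly_Mapping.lookup (koszul n w A l) m = (\<Sum>b\<in>{1..n} - A. - (ksign v B * t b))"
            unfolding L
          proof (intro sum.cong refl)
            fix b assume b: "b \<in> {1..n} - A"
            then have "b \<noteq> v" "b \<notin> B" using A by auto
            then have s: "ksign b A * ksign v (insert b B) = - (ksign v B * (ksign b B :: 'a))"
              using ksign_swap[of b v B] A by simp
            have "insert b A - {v} = insert b B" using A \<open>b \<noteq> v\<close> by auto
            then show "(if b \<in> Poly_Mapping.keys m then ksign b A * f (insert b A) l (m - Poly_Mapping.single b 1) else 0)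
              = - (ksign v B * t b)"
              using fb[OF b] s vA by (auto simp: t_def mult.assoc[symmetric])
          qed
          then have "Poly_Mapping.lookup (koszul n w A l) m = - (ksign v B * (\<Sum>b\<in>{1..n} - A. t b))"
            by (simp add: sum_negf sum_distrib_left)
          ultimately have "Poly_Mapping.lookup (koszul n w A l) m = ksign v B * (ksign v B * Poly_Mapping.lookup (z A l) m)"
            by (simp add: add_eq_0_iff)
          then show ?thesis
            by (simp add: mult.assoc[symmetric])
        qed
      qed
    qed
  qed
  moreover have "A \<subseteq> {1..n} \<and> c (m + expo A) \<in> A \<and>
      m + Poly_Mapping.single (c (m + expo A)) 1 \<in> Poly_Mapping.keys (z (A - {c (m + expo A)}) l)"
    if "m \<in> Poly_Mapping.keys (w A l)" for A l m
    using that by (auto simp: in_keys_iff look f_def ok_def split: if_splits)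
  ultimately show thesis using that by blast
qed

section \<open>Graded submodules of free modules\<close>

definition free_mod :: "nat \<Rightarrow> nat \<Rightarrow> 'a::field vec set" where
  "free_mod n r = {v. (\<forall>l. v l \<in> polys n) \<and> (\<forall>l\<ge>r. v l = 0)}"

definition smul :: "'a::field mpoly \<Rightarrow> 'a vec \<Rightarrow> 'a vec" where
  "smul p v = (\<lambda>l. p * v l)"

text \<open>
  The component of degree $j - i$ in $\bigoplus_l S(-s\,l)$. The offset $i$ is on the left of the
  equation to avoid truncated subtraction: for $i > j$ the component is zero.
\<close>

definition hcomp :: "(nat \<Rightarrow> nat) \<Rightarrow> nat \<Rightarrow> nat \<Rightarrow> 'a::field vec \<Rightarrow> 'a vec" where
  "hcomp s i j v = (\<lambda>l. filt (\<lambda>m. mon_deg m + s l + i = j) (v l))"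

text \<open>
  Closure under \<open>hcomp\<close> says that the submodule is homogeneous.
\<close>

definition graded_submodule :: "nat \<Rightarrow> nat \<Rightarrow> (nat \<Rightarrow> nat) \<Rightarrow> 'a::field vec set \<Rightarrow> bool" where
  "graded_submodule n r s M \<longleftrightarrow> M \<subseteq> free_mod n r \<and> 0 \<in> M \<and> (\<forall>v\<in>M. \<forall>w\<in>M. v + w \<in> M) \<and>
     (\<forall>p\<in>polys n. \<forall>v\<in>M. smul p v \<in> M) \<and> (\<forall>v\<in>M. \<forall>i j. hcomp s i j v \<in> M)"

lemma
  assumes "graded_submodule n r s M"
  shows submodule_free: "v \<in> M \<Longrightarrow> v \<in> free_mod n r"
    and submodule_0: "0 \<in> M"
    and submodule_add: "v \<in> M \<Longrightarrow> w \<in> M \<Longrightarrow> v + w \<in> M"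
    and submodule_smul: "p \<in> polys n \<Longrightarrow> v \<in> M \<Longrightarrow> smul p v \<in> M"
    and submodule_hcomp: "v \<in> M \<Longrightarrow> hcomp s i j v \<in> M"
  using assms by (auto simp: graded_submodule_def)

lemma submodule_uminus: "graded_submodule n r s M \<Longrightarrow> v \<in> M \<Longrightarrow> - v \<in> M"
  using submodule_smul[of n r s M "- 1" v] polys_const[of "- 1 :: 'a::field" n]
  by (simp add: smul_def fun_Compl_def single_uminus)

lemma submodule_sum: "graded_submodule n r s M \<Longrightarrow> (\<And>i. i \<in> A \<Longrightarrow> f i \<in> M) \<Longrightarrow> sum f A \<in> M"
  by (induction A rule: infinite_finite_induct) (auto intro: submodule_0 submodule_add)

lemma fun_sum_apply: "(sum f A) x = (\<Sum>a\<in>A. (f a x :: 'b::comm_monoid_add))"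
  by (induction A rule: infinite_finite_induct) (auto simp: fun_simps)

lemma hcomp_zero [simp]: "hcomp s i j 0 = 0"
  by (simp add: hcomp_def fun_eq_iff fun_simps)

lemma hcomp_id: "(\<And>l m. m \<in> Poly_Mapping.keys (v l) \<Longrightarrow> mon_deg m + s l + i = j) \<Longrightarrow> hcomp s i j v = v"
  by (auto simp: hcomp_def fun_eq_iff intro!: filt_id)

lemma submodule_free_mod: "graded_submodule n r s (free_mod n r)"
  by (auto simp: graded_submodule_def free_mod_def smul_def hcomp_def fun_simps
      intro: polys_add polys_mult filt_polys)

definition linmap :: "nat \<Rightarrow> nat \<Rightarrow> (nat \<Rightarrow> nat \<Rightarrow> 'a::field mpoly) \<Rightarrow> 'a vec \<Rightarrow> 'a vec" where
  "linmap r r' a v = (\<lambda>k. if k < r' then \<Sum>l<r. a k l * v l else 0)"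

lemma linmap_zero [simp]: "linmap r r' a 0 = 0"
  by (simp add: fun_simps linmap_def fun_eq_iff)

lemma linmap_add: "linmap r r' a (v + w) = linmap r r' a v + linmap r r' a w"
  by (simp add: fun_simps linmap_def fun_eq_iff distrib_left sum.distrib)

lemma linmap_diff: "linmap r r' a (v - w) = linmap r r' a v - linmap r r' a w"
  by (simp add: fun_simps linmap_def fun_eq_iff right_diff_distrib sum_subtractf)

lemma linmap_smul: "linmap r r' a (smul p v) = smul p (linmap r r' a v)"
  by (auto simp: linmap_def fun_eq_iff smul_def sum_distrib_left mult.left_commute)

lemma linmap_sum: "linmap r r' a (sum f A) = (\<Sum>i\<in>A. linmap r r' a (f i))"
  by (induction A rule: infinite_finite_induct) (auto simp: linmap_add)

definition graded_matrix where
  "graded_matrix n r s r' s' a \<longleftrightarrow> (\<forall>k<r'. \<forall>l<r. a k l \<in> polys n \<and>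
     (\<forall>m\<in>Poly_Mapping.keys (a k l). mon_deg m + s' k = (s l :: nat)))"

text \<open>
  A homogeneous matrix is a map of degree $0$ for the shifts, so it respects homogeneous components.
\<close>

lemma linmap_hcomp:
  assumes "graded_matrix n r s r' s' a"
  shows "linmap r r' a (hcomp s i j v) = hcomp s' i j (linmap r r' a v)"
proof
  fix k
  have "filt (\<lambda>m. mon_deg m + s' k + i = j) (a k l * v l) = a k l * filt (\<lambda>m. mon_deg m + s l + i = j) (v l)"
    if "k < r'" "l < r" for l
  proof (rule filt_mult)
    fix m m' assume "m \<in> Poly_Mapping.keys (a k l)"
    then have "mon_deg m + s' k = s l" using assms that by (auto simp: graded_matrix_def)
    then show "(mon_deg (m + m') + s' k + i = j) = (mon_deg m' + s l + i = j)" by auto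
  qed
  then show "linmap r r' a (hcomp s i j v) k = hcomp s' i j (linmap r r' a v) k"
    by (simp add: linmap_def hcomp_def filt_sum)
qed

lemma linmap_free: "graded_matrix n r s r' s' a \<Longrightarrow> v \<in> free_mod n r \<Longrightarrow> linmap r r' a v \<in> free_mod n r'"
  by (auto simp: free_mod_def linmap_def graded_matrix_def intro!: polys_sum polys_mult)

definition syzygies where
  "syzygies n r r' a = {v \<in> free_mod n r. linmap r r' a v = 0}"

lemma submodule_syzygies:
  assumes "graded_matrix n r s r' s' a"
  shows "graded_submodule n r s (syzygies n r r' a)"
  unfolding graded_submodule_def syzygies_def
  using submodule_add[OF submodule_free_mod] submodule_smul[OF submodule_free_mod] submodule_hcomp[OF submodule_free_mod, of _ n r s]
    submodule_0[OF submodule_free_mod, of n r]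
  by (auto simp: linmap_add linmap_smul linmap_hcomp[OF assms]) (auto simp: smul_def fun_simps fun_eq_iff)

text \<open>
  A graded surjection of a free module onto $M$ whose kernel lies in $\mathfrak{m}$ times the free
  module: one step of a minimal resolution.
\<close>

definition min_cover where
  "min_cover n r' s' M r s a \<longleftrightarrow> graded_matrix n r s r' s' a \<and> linmap r r' a ` free_mod n r = M \<and>
     (\<forall>v\<in>syzygies n r r' a. \<forall>l. Poly_Mapping.lookup (v l) 0 = 0)"

section \<open>Koszul homology\<close>

text \<open>
  $i$-chains with values in $M$ and total degree $j$, where each $e_b$ has degree $1$. With this
  convention the differential keeps $j$ fixed.
\<close>

definition koszul_chain ::
    "nat \<Rightarrow> (nat \<Rightarrow> nat) \<Rightarrow> 'a::field vec set \<Rightarrow> nat \<Rightarrow> nat \<Rightarrow> (nat set \<Rightarrow> 'a vec) \<Rightarrow> bool" where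
  "koszul_chain n s M i j z \<longleftrightarrow> (\<forall>A. z A \<in> M) \<and> (\<forall>A l m. m \<in> Poly_Mapping.keys (z A l) \<longrightarrow>
     A \<subseteq> {1..n} \<and> card A = i \<and> mon_deg m + s l + i = j)"

text \<open>
  $H_i(x_1,\dots,x_n; M)_j = 0$.
\<close>

definition koszul_zero_at :: "nat \<Rightarrow> (nat \<Rightarrow> nat) \<Rightarrow> 'a::field vec set \<Rightarrow> nat \<Rightarrow> nat \<Rightarrow> bool" where
  "koszul_zero_at n s M i j \<longleftrightarrow> (\<forall>z. koszul_chain n s M i j z \<and> koszul n z = 0 \<longrightarrow>
     (\<exists>w. koszul_chain n s M (Suc i) j w \<and> koszul n w = z))"

lemma chain_mem: "koszul_chain n s M i j z \<Longrightarrow> z A \<in> M"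
  by (simp add: koszul_chain_def)

lemma chain_keys:
  assumes "koszul_chain n s M i j z" "m \<in> Poly_Mapping.keys (z A l)"
  shows "A \<subseteq> {1..n}" "card A = i" "mon_deg m + s l + i = j"
  using assms unfolding koszul_chain_def by blast+

lemma vec_nonzero:
  assumes "v \<noteq> (0 :: 'a::field vec)"
  obtains l m where "m \<in> Poly_Mapping.keys (v l)"
proof -
  obtain l where "v l \<noteq> 0" using assms by (auto simp: fun_eq_iff fun_simps)
  then obtain m where "Poly_Mapping.lookup (v l) m \<noteq> 0"
    by (auto simp: poly_mapping_eq_iff fun_eq_iff)
  with that show thesis by (auto simp: in_keys_iff)
qed

lemma chain_add:
  assumes "graded_submodule n r s M" "koszul_chain n s M i j z" "koszul_chain n s M i j w"
  shows "koszul_chain n s M i j (z + w)"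
  unfolding koszul_chain_def
proof (intro conjI allI)
  show "(z + w) A \<in> M" for A
    using assms by (auto simp: koszul_chain_def fun_simps intro: submodule_add)
  fix A l m
  have "m \<in> Poly_Mapping.keys (z A l) \<or> m \<in> Poly_Mapping.keys (w A l)"
    if "m \<in> Poly_Mapping.keys ((z + w) A l)"
    using that keys_add[of "z A l" "w A l"] by (auto simp: fun_simps)
  then show "m \<in> Poly_Mapping.keys ((z + w) A l) \<longrightarrow> A \<subseteq> {1..n} \<and> card A = i \<and> mon_deg m + s l + i = j"
    using assms(2,3) unfolding koszul_chain_def by blast
qed

lemma chain_uminus:
  assumes "graded_submodule n r s M" "koszul_chain n s M i j z"
  shows "koszul_chain n s M i j (- z)"
  using assms unfolding koszul_chain_def by (auto simp: fun_simps intro: submodule_uminus)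

lemma chain_diff:
  assumes "graded_submodule n r s M" "koszul_chain n s M i j z" "koszul_chain n s M i j w"
  shows "koszul_chain n s M i j (z - w)"
  using chain_add[OF assms(1,2) chain_uminus[OF assms(1,3)]] by simp

lemma chain_mono: "koszul_chain n s M i j z \<Longrightarrow> (\<And>A. z A \<in> N) \<Longrightarrow> koszul_chain n s N i j z"
  by (auto simp: koszul_chain_def)

lemma keys_koszul:
  assumes "m \<in> Poly_Mapping.keys (koszul n z A l)"
  obtains b where "b \<in> {1..n} - A" "b \<in> Poly_Mapping.keys m"
    "m - Poly_Mapping.single b 1 \<in> Poly_Mapping.keys (z (insert b A) l)"
proof -
  have "(\<Sum>b\<in>{1..n} - A. if b \<in> Poly_Mapping.keys m
      then ksign b A * Poly_Mapping.lookup (z (insert b A) l) (m - Poly_Mapping.single b 1) else 0) \<noteq> 0"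
    using assms by (simp add: in_keys_iff koszul_def lookup_sum lookup_var_mult)
  then obtain b where "b \<in> {1..n} - A" "(if b \<in> Poly_Mapping.keys m
      then ksign b A * Poly_Mapping.lookup (z (insert b A) l) (m - Poly_Mapping.single b 1) else 0) \<noteq> 0"
    by (rule sum.not_neutral_contains_not_neutral)
  then show thesis
    by (intro that[of b]) (auto simp: in_keys_iff split: if_splits)
qed

lemma koszul_mem:
  assumes "graded_submodule n r s M" "\<And>A. z A \<in> M"
  shows "koszul n z A \<in> M"
proof -
  have "koszul n z A = (\<Sum>b\<in>{1..n} - A. smul (Poly_Mapping.single (Poly_Mapping.single b 1) (ksign b A)) (z (insert b A)))"
    by (auto simp: fun_eq_iff koszul_def fun_sum_apply smul_def fun_simps)
  also have "\<dots> \<in> M"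
    using assms by (intro submodule_sum submodule_smul polys_single) auto
  finally show ?thesis .
qed

lemma chain_koszul:
  assumes M: "graded_submodule n r s M" and z: "koszul_chain n s M (Suc i) j z"
  shows "koszul_chain n s M i j (koszul n z)"
  unfolding koszul_chain_def
proof (intro conjI allI impI)
  show "koszul n z A \<in> M" for A
    using z by (intro koszul_mem[OF M]) (simp add: koszul_chain_def)
next
  fix A l m assume "m \<in> Poly_Mapping.keys (koszul n z A l)"
  then obtain b where b: "b \<in> {1..n} - A" "b \<in> Poly_Mapping.keys m"
    "m - Poly_Mapping.single b 1 \<in> Poly_Mapping.keys (z (insert b A) l)"
    by (rule keys_koszul)
  then have c: "insert b A \<subseteq> {1..n}" "card (insert b A) = Suc i"
      "mon_deg (m - Poly_Mapping.single b 1) + s l + Suc i = j"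
    using z b(3) unfolding koszul_chain_def by blast+
  then show "A \<subseteq> {1..n}" by auto
  then have "finite A" using finite_subset by blast
  then show "card A = i" using c(2) b(1) by simp
  have "mon_deg m = mon_deg (m - Poly_Mapping.single b 1) + 1"
    using var_plus_minus[OF b(2)] mon_deg_add mon_deg_single by metis
  then show "mon_deg m + s l + i = j" using c(3) by simp
qed

lemma chain_0_koszul:
  assumes "koszul_chain n s M 0 j z"
  shows "koszul n z = 0"
proof
  fix A
  show "koszul n z A = 0 A"
  proof (rule ccontr)
    assume "koszul n z A \<noteq> 0 A"
    then have "koszul n z A \<noteq> 0" by (simp add: fun_simps)
    then obtain l m where "m \<in> Poly_Mapping.keys (koszul n z A l)"
      by (rule vec_nonzero)
    then obtain b where "m - Poly_Mapping.single b 1 \<in> Poly_Mapping.keys (z (insert b A) l)"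
      by (rule keys_koszul)
    then have "insert b A \<subseteq> {1..n}" "card (insert b A) = 0"
      using chain_keys[OF assms] by metis+
    then show False using finite_subset[of "insert b A" "{1..n}"] by auto
  qed
qed

text \<open>
  The contraction for homogeneous chains. The new chain has coefficients in the free module only;
  membership in a smaller module has to be read off from the last conclusion.
\<close>

lemma contract_chain:
  assumes z: "koszul_chain n s M i j z" and M: "M \<subseteq> free_mod n r" and cyc: "koszul n z = 0"
    and const: "\<And>l. Poly_Mapping.lookup (z {} l) 0 = 0"
    and choice: "\<And>u. u \<noteq> 0 \<Longrightarrow> c u \<in> Poly_Mapping.keys u"
  obtains w where "koszul n w = z" and "koszul_chain n s (free_mod n r) (Suc i) j w"
    and "\<And>A l m. m \<in> Poly_Mapping.keys (w A l) \<Longrightarrow> A \<subseteq> {1..n} \<and> c (m + expo A) \<in> A \<and>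
      m + Poly_Mapping.single (c (m + expo A)) 1 \<in> Poly_Mapping.keys (z (A - {c (m + expo A)}) l)"
proof -
  have zf: "z A \<in> free_mod n r" for A
    using z M by (auto simp: koszul_chain_def)
  have supp: "A \<subseteq> {1..n} \<and> Poly_Mapping.keys m \<subseteq> {1..n}" if "m \<in> Poly_Mapping.keys (z A l)" for A l m
    using chain_keys(1)[OF z that] zf[of A] that by (auto simp: free_mod_def polys_def)
  obtain w where w: "koszul n w = z"
    "\<And>A l m. m \<in> Poly_Mapping.keys (w A l) \<Longrightarrow> A \<subseteq> {1..n} \<and> c (m + expo A) \<in> A \<and>
      m + Poly_Mapping.single (c (m + expo A)) 1 \<in> Poly_Mapping.keys (z (A - {c (m + expo A)}) l)"
    by (rule koszul_contract[of n z c]) (use cyc supp const choice in blast)+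
  have "w A \<in> free_mod n r" for A
    unfolding free_mod_def
  proof (intro CollectI conjI allI impI)
    fix l
    have "Poly_Mapping.keys m \<subseteq> {1..n}" if m: "m \<in> Poly_Mapping.keys (w A l)" for m
      using supp[OF conjunct2[OF conjunct2[OF w(2)[OF m]]]] by (simp add: keys_plus_nat)
    then show "w A l \<in> polys n" by (simp add: polys_def)
    assume "r \<le> l"
    then have "z B l = 0" for B using zf[of B] by (simp add: free_mod_def)
    then have "m \<notin> Poly_Mapping.keys (w A l)" for m
      using w(2)[of m A l] by auto
    then show "w A l = 0" by (intro poly_mapping_eqI) (simp add: in_keys_iff)
  qed
  moreover have "A \<subseteq> {1..n} \<and> card A = Suc i \<and> mon_deg m + s l + Suc i = j"
    if m: "m \<in> Poly_Mapping.keys (w A l)" for A l m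
  proof -
    have "A \<subseteq> {1..n}" using w(2)[OF m] by simp
    then have fin: "finite A" using finite_subset by blast
    define v where "v = c (m + expo A)"
    have v: "v \<in> A" "m + Poly_Mapping.single v 1 \<in> Poly_Mapping.keys (z (A - {v}) l)"
      using w(2)[OF m] by (auto simp: v_def)
    have "card (A - {v}) = i" "mon_deg (m + Poly_Mapping.single v 1) + s l + i = j"
      using chain_keys(2,3)[OF z v(2)] by simp_all
    then show ?thesis
      using card.remove[OF fin v(1)] \<open>A \<subseteq> {1..n}\<close> by simp
  qed
  ultimately have "koszul_chain n s (free_mod n r) (Suc i) j w"
    unfolding koszul_chain_def by blast
  with w that show thesis by blast
qed

text \<open>
  In a free module any choice of a variable dividing $x^u$ works, so positive homology vanishes.
  In homological degree $0$ exactly the elements of $\mathfrak{m} S^r$ are boundaries.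
\<close>

lemma free_mod_exact:
  assumes "koszul_chain n s (free_mod n r) i j z" "koszul n z = 0"
    and "\<And>l. Poly_Mapping.lookup (z {} l) 0 = 0"
  obtains w where "koszul_chain n s (free_mod n r) (Suc i) j w" "koszul n w = z"
proof -
  have "(SOME v. v \<in> Poly_Mapping.keys u) \<in> Poly_Mapping.keys u" if "u \<noteq> 0" for u :: "nat \<Rightarrow>\<^sub>0 nat"
  proof -
    have "\<exists>v. v \<in> Poly_Mapping.keys u"
      using that by (auto simp: poly_mapping_eq_iff fun_eq_iff in_keys_iff)
    then show ?thesis by (rule someI_ex)
  qed
  then show thesis
    by (rule contract_chain[OF assms(1) subset_refl assms(2,3), where c = "\<lambda>u. SOME v. v \<in> Poly_Mapping.keys u"])
      (use that in blast)+
qed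

lemma linmap_koszul: "koszul n (\<lambda>A. linmap r r' a (z A)) A = linmap r r' a (koszul n z A)"
proof -
  have e: "koszul n z A = (\<Sum>b\<in>{1..n} - A. smul (Poly_Mapping.single (Poly_Mapping.single b 1) (ksign b A)) (z (insert b A)))"
    for z :: "nat set \<Rightarrow> 'a vec"
    by (auto simp: fun_eq_iff koszul_def fun_sum_apply smul_def fun_simps)
  show ?thesis unfolding e by (simp add: linmap_sum linmap_smul)
qed

lemma linmap_keys_degree:
  assumes "graded_matrix n r s r' s' a" "\<And>l m. m \<in> Poly_Mapping.keys (v l) \<Longrightarrow> mon_deg m + s l + i = j"
    and "m \<in> Poly_Mapping.keys (linmap r r' a v k)"
  shows "mon_deg m + s' k + i = j"
proof -
  have "hcomp s' i j (linmap r r' a v) = linmap r r' a v"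
    using linmap_hcomp[OF assms(1), of i j v] hcomp_id[of v s i j, OF assms(2)] by simp
  then have "m \<in> Poly_Mapping.keys (hcomp s' i j (linmap r r' a v) k)"
    using assms(3) by simp
  then show ?thesis by (simp add: hcomp_def keys_filt)
qed

lemma chain_linmap:
  assumes c: "min_cover n r' s' M r s a" and z: "koszul_chain n s (free_mod n r) i j z"
  shows "koszul_chain n s' M i j (\<lambda>A. linmap r r' a (z A))"
  unfolding koszul_chain_def
proof (intro conjI allI impI)
  have z': "z A \<in> free_mod n r" for A using z by (simp add: koszul_chain_def)
  then show "linmap r r' a (z A) \<in> M" for A
    using c unfolding min_cover_def by blast
  fix A l m assume m: "m \<in> Poly_Mapping.keys (linmap r r' a (z A) l)"
  then have "z A \<noteq> 0" by (auto simp: fun_simps)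
  then obtain k m' where "m' \<in> Poly_Mapping.keys (z A k)"
    by (rule vec_nonzero)
  then show "A \<subseteq> {1..n}" "card A = i" using chain_keys[OF z] by blast+
  show "mon_deg m + s' l + i = j"
    using c m by (intro linmap_keys_degree[of n r s r' s' a "z A" i j m l] chain_keys(3)[OF z])
      (auto simp: min_cover_def)
qed

text \<open>
  Choose preimages pointwise and keep only their component of the correct degree; the cover respects
  the grading.
\<close>

lemma chain_lift:
  assumes c: "min_cover n r' s' M r s a" and z: "koszul_chain n s' M i j z"
  obtains y where "koszul_chain n s (free_mod n r) i j y" "\<And>A. linmap r r' a (y A) = z A"
proof -
  have "\<exists>v. v \<in> free_mod n r \<and> linmap r r' a v = z A" for A
    using c chain_mem[OF z, of A] unfolding min_cover_def by (metis imageE)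
  then obtain f where f: "\<And>A. f A \<in> free_mod n r" "\<And>A. linmap r r' a (f A) = z A" by metis
  define y where "y A = (if A \<subseteq> {1..n} \<and> card A = i then hcomp s i j (f A) else 0)" for A
  have "linmap r r' a (y A) = z A" for A
  proof (cases "A \<subseteq> {1..n} \<and> card A = i")
    case True
    have "linmap r r' a (y A) = hcomp s' i j (z A)"
      using True linmap_hcomp[of n r s r' s' a i j "f A"] c by (simp add: y_def min_cover_def f(2))
    also have "\<dots> = z A" by (intro hcomp_id chain_keys(3)[OF z])
    finally show ?thesis .
  next
    case False
    then have "z A = 0"
      using chain_keys[OF z, of _ A] by (meson vec_nonzero)
    then show ?thesis using False by (auto simp: y_def)
  qed
  moreover have "koszul_chain n s (free_mod n r) i j y"
    unfolding koszul_chain_def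
  proof (intro conjI allI impI)
    show "y A \<in> free_mod n r" for A
      using submodule_hcomp[OF submodule_free_mod f(1)] by (simp add: y_def submodule_0[OF submodule_free_mod])
    fix A l m assume m: "m \<in> Poly_Mapping.keys (y A l)"
    then have A: "A \<subseteq> {1..n} \<and> card A = i"
      by (auto simp: y_def fun_simps split: if_splits)
    then show "A \<subseteq> {1..n}" "card A = i" by auto
    show "mon_deg m + s l + i = j"
      using m A by (simp add: y_def hcomp_def keys_filt)
  qed
  ultimately show thesis using that by blast
qed

text \<open>
  The connecting map of $0 \to N \to S^r \to M \to 0$. For $i > 0$ it is an isomorphism
  $H_{i+1}(M) \cong H_i(N)$, because the homology of $S^r$ vanishes. For $i = 0$ minimality enters:
  $N \subseteq \mathfrak{m} S^r$ makes every element of $N$ a boundary in $S^r$.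
\<close>

lemma koszul_shift:
  assumes c: "min_cover n r' s' M r s a"
  shows "koszul_zero_at n s' M (Suc i) j \<longleftrightarrow> koszul_zero_at n s (syzygies n r r' a) i j"
proof
  have gm: "graded_matrix n r s r' s' a" using c by (simp add: min_cover_def)
  note gN = submodule_syzygies[OF gm]
  note gF = submodule_free_mod[of n r s]
  have NF: "syzygies n r r' a \<subseteq> free_mod n r" by (auto simp: syzygies_def)
  assume L: "koszul_zero_at n s' M (Suc i) j"
  show "koszul_zero_at n s (syzygies n r r' a) i j"
    unfolding koszul_zero_at_def
  proof (intro allI impI)
    fix z assume z: "koszul_chain n s (syzygies n r r' a) i j z \<and> koszul n z = 0"
    have zF: "koszul_chain n s (free_mod n r) i j z"
      using z NF by (auto simp: koszul_chain_def)
    have "Poly_Mapping.lookup (z {} l) 0 = 0" for l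
      using z c by (auto simp: koszul_chain_def min_cover_def)
    then obtain y where y: "koszul_chain n s (free_mod n r) (Suc i) j y" "koszul n y = z"
      using free_mod_exact[OF zF] z by metis
    have "koszul n (\<lambda>A. linmap r r' a (y A)) = 0"
      using z by (auto simp: fun_eq_iff[of _ 0] linmap_koszul y(2) fun_simps koszul_chain_def syzygies_def)
    then obtain w where w: "koszul_chain n s' M (Suc (Suc i)) j w" "koszul n w = (\<lambda>A. linmap r r' a (y A))"
      using L chain_linmap[OF c y(1)] unfolding koszul_zero_at_def by blast
    obtain w' where w': "koszul_chain n s (free_mod n r) (Suc (Suc i)) j w'" "\<And>A. linmap r r' a (w' A) = w A"
      using chain_lift[OF c w(1)] by blast
    have "koszul_chain n s (free_mod n r) (Suc i) j (y - koszul n w')"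
      by (intro chain_diff[OF gF] y(1) chain_koszul[OF gF] w'(1))
    moreover have "linmap r r' a ((y - koszul n w') A) = 0" for A
      using fun_cong[OF w(2), of A] by (simp add: fun_simps(3) linmap_diff w'(2) flip: linmap_koszul)
    ultimately have "koszul_chain n s (syzygies n r r' a) (Suc i) j (y - koszul n w')"
      by (auto simp: koszul_chain_def syzygies_def)
    moreover have "koszul n (y - koszul n w') = z"
      by (simp add: koszul_diff koszul_koszul y(2))
    ultimately show "\<exists>w. koszul_chain n s (syzygies n r r' a) (Suc i) j w \<and> koszul n w = z" by blast
  qed
next
  have gm: "graded_matrix n r s r' s' a" using c by (simp add: min_cover_def)
  note gN = submodule_syzygies[OF gm]
  note gF = submodule_free_mod[of n r s]
  assume R: "koszul_zero_at n s (syzygies n r r' a) i j"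
  show "koszul_zero_at n s' M (Suc i) j"
    unfolding koszul_zero_at_def
  proof (intro allI impI)
    fix z assume z: "koszul_chain n s' M (Suc i) j z \<and> koszul n z = 0"
    then obtain y where y: "koszul_chain n s (free_mod n r) (Suc i) j y" "\<And>A. linmap r r' a (y A) = z A"
      using chain_lift[OF c] by blast
    have "linmap r r' a (koszul n y A) = 0" for A
      using z y(2) by (simp add: fun_simps(2) flip: linmap_koszul)
    then have "koszul_chain n s (syzygies n r r' a) i j (koszul n y)"
      using chain_koszul[OF gF y(1)] by (auto simp: koszul_chain_def syzygies_def)
    then obtain x where x: "koszul_chain n s (syzygies n r r' a) (Suc i) j x" "koszul n x = koszul n y"
      using R koszul_koszul unfolding koszul_zero_at_def by metis
    have xF: "koszul_chain n s (free_mod n r) (Suc i) j (y - x)"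
      by (intro chain_diff[OF gF] y(1) chain_mono[OF x(1)]) (use x(1) in \<open>auto simp: koszul_chain_def syzygies_def\<close>)
    have "koszul n (y - x) = 0" by (simp add: koszul_diff x(2))
    moreover have "Poly_Mapping.lookup ((y - x) {} l) 0 = 0" for l
    proof -
      have "0 \<notin> Poly_Mapping.keys ((y - x) {} l)"
        using xF unfolding koszul_chain_def by (metis card.empty nat.distinct(1))
      then show ?thesis by (simp add: in_keys_iff)
    qed
    ultimately obtain w where w: "koszul_chain n s (free_mod n r) (Suc (Suc i)) j w" "koszul n w = y - x"
      using free_mod_exact[OF xF] by blast
    have "koszul n (\<lambda>A. linmap r r' a (w A)) A = z A" for A
      using x(1) by (simp add: fun_simps(3) linmap_koszul w(2) linmap_diff y(2) koszul_chain_def syzygies_def)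
    then show "\<exists>w. koszul_chain n s' M (Suc (Suc i)) j w \<and> koszul n w = z"
      using chain_linmap[OF c w(1)] by blast
  qed
qed

section \<open>Minimal resolutions and Koszul homology\<close>

text \<open>
  $H_0(M) = M / \mathfrak{m} M$, and by minimality the images of the basis elements of $S^r$ form
  a basis of it.
\<close>

lemma koszul_0_iff:
  assumes c: "min_cover n r' s' M r s a"
  shows "koszul_zero_at n s' M 0 j \<longleftrightarrow> \<not> (\<exists>l<r. s l = j)"
proof
  note gF = submodule_free_mod[of n r s]
  assume L: "koszul_zero_at n s' M 0 j"
  show "\<not> (\<exists>l<r. s l = j)"
  proof
    assume "\<exists>l<r. s l = j"
    then obtain l where l: "l < r" "s l = j" by blast
    \<comment> \<open>If the image of the basis element \<open>e_l\<close> were in the maximal ideal times \<open>M\<close>, a syzygy with constant term 1 would exist.\<close>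
    define z where "z A k = (if A = {} \<and> k = l then 1 else 0 :: 'a mpoly)" for A :: "nat set" and k
    have z: "koszul_chain n s (free_mod n r) 0 j z"
      using l by (auto simp: koszul_chain_def free_mod_def z_def polys_def split: if_splits)
    note z' = chain_linmap[OF c z]
    obtain w where w: "koszul_chain n s' M (Suc 0) j w" "koszul n w = (\<lambda>A. linmap r r' a (z A))"
      using L z' chain_0_koszul[OF z'] unfolding koszul_zero_at_def by blast
    obtain y where y: "koszul_chain n s (free_mod n r) (Suc 0) j y" "\<And>A. linmap r r' a (y A) = w A"
      using chain_lift[OF c w(1)] by blast
    have "(z - koszul n y) {} \<in> free_mod n r"
      using chain_diff[OF gF z chain_koszul[OF gF y(1)]] by (rule chain_mem)
    moreover have "linmap r r' a ((z - koszul n y) {}) = 0"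
      using fun_cong[OF w(2), of "{}"] by (simp add: fun_simps(3) linmap_diff y(2) flip: linmap_koszul)
    ultimately have "Poly_Mapping.lookup ((z - koszul n y) {} l) 0 = 0"
      using c by (auto simp: min_cover_def syzygies_def)
    moreover have "Poly_Mapping.lookup (koszul n y {} l) 0 = 0"
    proof (rule ccontr)
      assume "Poly_Mapping.lookup (koszul n y {} l) 0 \<noteq> 0"
      then have "0 \<in> Poly_Mapping.keys (koszul n y {} l)" by (simp add: in_keys_iff)
      then show False by (rule keys_koszul) simp
    qed
    ultimately show False by (simp add: fun_simps(3) lookup_minus z_def)
  qed
next
  assume R: "\<not> (\<exists>l<r. s l = j)"
  show "koszul_zero_at n s' M 0 j"
    unfolding koszul_zero_at_def
  proof (intro allI impI)
    fix z assume z: "koszul_chain n s' M 0 j z \<and> koszul n z = 0"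
    then obtain y where y: "koszul_chain n s (free_mod n r) 0 j y" "\<And>A. linmap r r' a (y A) = z A"
      using chain_lift[OF c] by blast
    have "Poly_Mapping.lookup (y {} l) 0 = 0" for l
    proof (cases "l < r")
      case True
      then have "0 \<notin> Poly_Mapping.keys (y {} l)"
        using chain_keys(3)[OF y(1), of 0 "{}" l] R by auto
      then show ?thesis by (simp add: in_keys_iff)
    next
      case False
      then show ?thesis using chain_mem[OF y(1), of "{}"] by (simp add: free_mod_def)
    qed
    then obtain w where w: "koszul_chain n s (free_mod n r) (Suc 0) j w" "koszul n w = y"
      using free_mod_exact[OF y(1) chain_0_koszul[OF y(1)]] by blast
    have "koszul n (\<lambda>A. linmap r r' a (w A)) = z"
      by (simp add: fun_eq_iff[of _ z] linmap_koszul w(2) y(2))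
    then show "\<exists>w. koszul_chain n s' M (Suc 0) j w \<and> koszul n w = z"
      using chain_linmap[OF c w(1)] by blast
  qed
qed

text \<open>
  A minimal resolution in the form of its syzygy modules \<open>md k\<close>, with the resolved module at
  $k = 0$. Hence \<open>rk (Suc i)\<close> is the rank of the $i$-th free module.
\<close>

definition syzygy_tower where
  "syzygy_tower n rk sh md mat \<longleftrightarrow> (\<forall>k.
     min_cover n (rk k) (sh k) (md k) (rk (Suc k)) (sh (Suc k)) (mat k) \<and>
     md (Suc k) = syzygies n (rk (Suc k)) (rk k) (mat k))"

text \<open>
  Dimension shifting moves along the tower until homological degree $0$ is reached.
\<close>

lemma tower_koszul:
  assumes "syzygy_tower n rk sh md mat"
  shows "koszul_zero_at n (sh k) (md k) i j \<longleftrightarrow> \<not> (\<exists>l<rk (Suc (k + i)). sh (Suc (k + i)) l = j)"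
proof (induction i arbitrary: k)
  case 0
  then show ?case using assms koszul_0_iff unfolding syzygy_tower_def by (metis add_0_right)
next
  case (Suc i)
  have "koszul_zero_at n (sh k) (md k) (Suc i) j \<longleftrightarrow> koszul_zero_at n (sh (Suc k)) (md (Suc k)) i j"
    using assms koszul_shift unfolding syzygy_tower_def by metis
  then show ?case using Suc.IH[of "Suc k"] by simp
qed

text \<open>
  Polynomials as vectors of length $1$, so that an ideal is a submodule of $S^1$ and the augmentation
  is treated like the other maps.
\<close>

definition vec1 :: "'a::field mpoly \<Rightarrow> 'a vec" where
  "vec1 p k = (if k = 0 then p else 0)"

lemma linmap_trunc: "linmap r r' a (\<lambda>l. if l < r then v l else 0) = linmap r r' a v"
  by (auto simp: linmap_def fun_eq_iff intro!: sum.cong)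

lemma trunc_free: "(\<And>l. v l \<in> polys n) \<Longrightarrow> (\<lambda>l. if l < r then v l else 0) \<in> free_mod n r"
  by (simp add: free_mod_def)

lemma linmap_aug: "linmap (rank F 0) 1 (\<lambda>k l. aug F l) v = vec1 (aug_map F v)"
  by (auto simp: linmap_def vec1_def aug_map_def fun_eq_iff)

lemma linmap_diff_map:
  "linmap (rank F (Suc i)) (rank F i) (diff F i) v = (\<lambda>k. if k < rank F i then diff_map F i v k else 0)"
  by (auto simp: linmap_def diff_map_def fun_eq_iff)

lemma vec1_eq_0_iff [simp]: "vec1 p = 0 \<longleftrightarrow> p = 0"
  by (auto simp: vec1_def fun_eq_iff fun_simps)

lemma resolution_tower:
  assumes F: "minimal_graded_free_resolution n I F"
  obtains rk sh md mat where "syzygy_tower n rk sh md mat" "rk 0 = 1" "sh 0 = (\<lambda>_. 0)" "md 0 = vec1 ` I"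
    "\<And>i. rk (Suc i) = rank F i" "\<And>i. sh (Suc i) = shift F i"
proof -
  define rk where "rk i = (case i of 0 \<Rightarrow> 1 | Suc k \<Rightarrow> rank F k)" for i
  define sh where "sh i = (case i of 0 \<Rightarrow> (\<lambda>_. 0) | Suc k \<Rightarrow> shift F k)" for i
  define mat where "mat i = (case i of 0 \<Rightarrow> (\<lambda>k l. aug F l) | Suc k \<Rightarrow> diff F k)" for i
  define md where "md i = (case i of 0 \<Rightarrow> vec1 ` I | Suc k \<Rightarrow> syzygies n (rk (Suc k)) (rk k) (mat k))" for i
  have G: "graded_maps n F" and R: "resolves n I F"
    and min: "\<And>i k l. k < rank F i \<Longrightarrow> l < rank F (Suc i) \<Longrightarrow> Poly_Mapping.lookup (diff F i k l) 0 = 0"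
    using F by (auto simp: minimal_graded_free_resolution_def)
  have gm: "graded_matrix n (rk (Suc i)) (sh (Suc i)) (rk i) (sh i) (mat i)" for i
    using G by (cases i) (auto simp: graded_matrix_def rk_def sh_def mat_def graded_maps_def)
  have im: "linmap (rk (Suc (Suc i))) (rk (Suc i)) (mat (Suc i)) ` free_mod n (rk (Suc (Suc i))) =
      syzygies n (rk (Suc i)) (rk i) (mat i)" for i
  proof -
    have ker: "linmap (rk (Suc i)) (rk i) (mat i) v = 0 \<longleftrightarrow>
        (\<exists>w. (\<forall>l. w l \<in> polys n) \<and> (\<forall>k<rank F i. v k = diff_map F i w k))"
      if "\<And>l. v l \<in> polys n" for v
    proof (cases i)
      case 0
      then show ?thesis
        using R that by (simp add: rk_def mat_def linmap_aug resolves_def)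
    next
      case (Suc k)
      then show ?thesis
        using R that by (auto simp add: rk_def mat_def linmap_diff_map resolves_def fun_eq_iff[of _ 0] fun_simps)
    qed
    show ?thesis
    proof (intro equalityI subsetI)
      fix v assume "v \<in> linmap (rk (Suc (Suc i))) (rk (Suc i)) (mat (Suc i)) ` free_mod n (rk (Suc (Suc i)))"
      then obtain w where w: "w \<in> free_mod n (rk (Suc (Suc i)))" "v = linmap (rk (Suc (Suc i))) (rk (Suc i)) (mat (Suc i)) w"
        by blast
      have v: "v \<in> free_mod n (rk (Suc i))"
        using linmap_free[OF gm] w by blast
      moreover have "v k = diff_map F i w k" if "k < rank F i" for k
        using that by (simp add: w(2) rk_def mat_def linmap_diff_map)
      ultimately show "v \<in> syzygies n (rk (Suc i)) (rk i) (mat i)"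
        using w(1) ker[of v] by (auto simp: syzygies_def free_mod_def)
    next
      fix v assume v: "v \<in> syzygies n (rk (Suc i)) (rk i) (mat i)"
      then obtain w where w: "\<And>l. w l \<in> polys n" "\<And>k. k < rank F i \<Longrightarrow> v k = diff_map F i w k"
        using ker[of v] by (auto simp: syzygies_def free_mod_def)
      have "v = linmap (rank F (Suc i)) (rank F i) (diff F i) w"
        unfolding linmap_diff_map using v w(2) by (auto simp: fun_eq_iff syzygies_def free_mod_def rk_def)
      also have "\<dots> = linmap (rank F (Suc i)) (rank F i) (diff F i) (\<lambda>l. if l < rank F (Suc i) then w l else 0)"
        by (simp add: linmap_trunc)
      finally show "v \<in> linmap (rk (Suc (Suc i))) (rk (Suc i)) (mat (Suc i)) ` free_mod n (rk (Suc (Suc i)))"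
        using trunc_free[of w n "rank F (Suc i)"] w(1) by (auto simp: rk_def mat_def)
    qed
  qed
  have const: "Poly_Mapping.lookup (v l) 0 = 0" if v: "v \<in> syzygies n (rk (Suc i)) (rk i) (mat i)" for v i l
  proof (cases "l < rank F i")
    case True
    obtain w where "v = linmap (rk (Suc (Suc i))) (rk (Suc i)) (mat (Suc i)) w"
      using v unfolding im[symmetric] by blast
    then have "v l = diff_map F i w l" using True by (simp add: rk_def mat_def linmap_diff_map)
    then show ?thesis using min[OF True] by (simp add: diff_map_def lookup_sum lookup_mult_0)
  qed (use v in \<open>simp add: syzygies_def free_mod_def rk_def\<close>)
  have im0: "linmap (rk (Suc 0)) (rk 0) (mat 0) ` free_mod n (rk (Suc 0)) = vec1 ` I"
  proof -
    have I: "I = {aug_map F v | v. \<forall>l. v l \<in> polys n}" using R by (simp add: resolves_def)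
    have "vec1 (aug_map F v) \<in> (\<lambda>v. vec1 (aug_map F v)) ` free_mod n (rank F 0)" if "\<forall>l. v l \<in> polys n" for v
    proof -
      have "vec1 (aug_map F v) = vec1 (aug_map F (\<lambda>l. if l < rank F 0 then v l else 0))"
        by (simp flip: linmap_aug add: linmap_trunc)
      then show ?thesis using trunc_free[of v n "rank F 0"] that by blast
    qed
    then show ?thesis
      unfolding I by (auto simp: rk_def mat_def linmap_aug) (auto simp: free_mod_def)
  qed
  have "min_cover n (rk k) (sh k) (md k) (rk (Suc k)) (sh (Suc k)) (mat k)" for k
    unfolding min_cover_def using gm const im im0
    by (cases k) (auto simp: md_def)
  then have "syzygy_tower n rk sh md mat"
    by (simp add: syzygy_tower_def md_def)
  then show thesis
    by (rule that) (auto simp: rk_def sh_def md_def)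
qed

lemma tower_resolution:
  assumes T: "syzygy_tower n rk sh md mat" and "rk 0 = 1" "sh 0 = (\<lambda>_. 0)" "md 0 = vec1 ` I"
  shows "\<exists>F. minimal_graded_free_resolution n I F"
proof -
  define F where "F = \<lparr>rank = \<lambda>i. rk (Suc i), shift = \<lambda>i. sh (Suc i), aug = mat 0 0, diff = \<lambda>i. mat (Suc i)\<rparr>"
  have F [simp]: "rank F i = rk (Suc i)" "shift F i = sh (Suc i)" "aug F = mat 0 0" "diff F i = mat (Suc i)" for i
    by (simp_all add: F_def)
  have gm: "graded_matrix n (rk (Suc k)) (sh (Suc k)) (rk k) (sh k) (mat k)"
    and im: "linmap (rk (Suc k)) (rk k) (mat k) ` free_mod n (rk (Suc k)) = md k"
    and const: "\<And>v l. v \<in> md (Suc k) \<Longrightarrow> Poly_Mapping.lookup (v l) 0 = 0"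
    and md: "md (Suc k) = syzygies n (rk (Suc k)) (rk k) (mat k)" for k
    using T unfolding syzygy_tower_def min_cover_def by auto
  have aug: "vec1 (aug_map F v) = linmap (rk (Suc 0)) (rk 0) (mat 0) v" for v
    by (auto simp: linmap_def vec1_def aug_map_def assms(2) fun_eq_iff)
  have ker: "linmap (rk (Suc k)) (rk k) (mat k) v = 0 \<longleftrightarrow>
      (\<exists>w. (\<forall>l. w l \<in> polys n) \<and> (\<forall>i<rk (Suc k). v i = diff_map F k w i))"
    if v: "\<forall>l. v l \<in> polys n" for v k
  proof -
    let ?v = "\<lambda>l. if l < rk (Suc k) then v l else 0"
    have "linmap (rk (Suc k)) (rk k) (mat k) v = 0 \<longleftrightarrow> ?v \<in> md (Suc k)"
      using trunc_free[of v n "rk (Suc k)"] v by (simp add: md syzygies_def linmap_trunc)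
    also have "\<dots> \<longleftrightarrow> (\<exists>w. w \<in> free_mod n (rk (Suc (Suc k))) \<and> ?v = linmap (rk (Suc (Suc k))) (rk (Suc k)) (mat (Suc k)) w)"
      unfolding im[symmetric] by blast
    also have "\<dots> \<longleftrightarrow> (\<exists>w. w \<in> free_mod n (rk (Suc (Suc k))) \<and> (\<forall>i<rk (Suc k). v i = diff_map F k w i))"
      using linmap_diff_map[of F k] by (auto simp: fun_eq_iff)
    also have "\<dots> \<longleftrightarrow> (\<exists>w. (\<forall>l. w l \<in> polys n) \<and> (\<forall>i<rk (Suc k). v i = diff_map F k w i))"
    proof
      assume "\<exists>w. (\<forall>l. w l \<in> polys n) \<and> (\<forall>i<rk (Suc k). v i = diff_map F k w i)"
      then obtain w where w: "\<forall>l. w l \<in> polys n" "\<forall>i<rk (Suc k). v i = diff_map F k w i" by blast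
      have "diff_map F k w = diff_map F k (\<lambda>l. if l < rk (Suc (Suc k)) then w l else 0)"
        by (auto simp: diff_map_def fun_eq_iff intro!: sum.cong)
      then show "\<exists>w. w \<in> free_mod n (rk (Suc (Suc k))) \<and> (\<forall>i<rk (Suc k). v i = diff_map F k w i)"
        using trunc_free[of w n "rk (Suc (Suc k))"] w by metis
    qed (auto simp: free_mod_def)
    finally show ?thesis .
  qed
  have "{aug_map F v | v. \<forall>l. v l \<in> polys n} = I"
  proof -
    have "vec1 ` {aug_map F v | v. \<forall>l. v l \<in> polys n} = linmap (rk (Suc 0)) (rk 0) (mat 0) ` free_mod n (rk (Suc 0))"
      (is "?A = ?B")
    proof
      show "?A \<subseteq> ?B"
      proof
        fix x assume "x \<in> ?A"
        then obtain v where v: "\<forall>l. v l \<in> polys n" "x = linmap (rk (Suc 0)) (rk 0) (mat 0) v"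
          by (auto simp: aug)
        then have "x = linmap (rk (Suc 0)) (rk 0) (mat 0) (\<lambda>l. if l < rk (Suc 0) then v l else 0)"
          by (simp add: linmap_trunc)
        then show "x \<in> ?B" using trunc_free[of v n "rk (Suc 0)"] v by blast
      qed
      show "?B \<subseteq> ?A"
        unfolding aug[symmetric] by (auto simp: free_mod_def)
    qed
    then have "vec1 ` {aug_map F v | v. \<forall>l. v l \<in> polys n} = vec1 ` I"
      using im[of 0] assms(4) by simp
    moreover have "inj (vec1 :: 'a mpoly \<Rightarrow> 'a vec)"
      by (rule injI) (metis vec1_def)
    ultimately show ?thesis by (simp add: inj_image_eq_iff)
  qed
  moreover have "aug_map F v = 0 \<longleftrightarrow> linmap (rk (Suc 0)) (rk 0) (mat 0) v = 0" for v
    by (simp flip: aug)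
  moreover have "(\<forall>k<rk (Suc i). diff_map F i v k = 0) \<longleftrightarrow> linmap (rk (Suc (Suc i))) (rk (Suc i)) (mat (Suc i)) v = 0" for i v
    using linmap_diff_map[of F i v] by (auto simp: fun_eq_iff fun_simps)
  ultimately have "resolves n I F"
    unfolding resolves_def using ker by simp
  moreover have "graded_maps n F"
    unfolding graded_maps_def using gm[of 0] gm assms(2,3) by (auto simp: graded_matrix_def)
  moreover have "Poly_Mapping.lookup (mat (Suc i) k l) 0 = 0" if "k < rk (Suc i)" "l < rk (Suc (Suc i))" for i k l
  proof -
    let ?e = "\<lambda>m. if m = l then 1 else 0 :: 'a mpoly"
    have "?e \<in> free_mod n (rk (Suc (Suc i)))"
      using that by (auto simp: free_mod_def polys_def)
    then have "linmap (rk (Suc (Suc i))) (rk (Suc i)) (mat (Suc i)) ?e \<in> md (Suc i)"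
      unfolding im[symmetric] by blast
    then have "Poly_Mapping.lookup (linmap (rk (Suc (Suc i))) (rk (Suc i)) (mat (Suc i)) ?e k) 0 = 0"
      by (rule const)
    then show ?thesis
      using that by (simp add: linmap_def if_distrib cong: if_cong)
  qed
  ultimately show ?thesis
    unfolding minimal_graded_free_resolution_def by (intro exI[of _ F]) simp
qed

section \<open>Existence of minimal resolutions\<close>

definition span_over :: "nat \<Rightarrow> 'a::field vec set \<Rightarrow> 'a vec set" where
  "span_over n G = {\<Sum>g\<in>G. smul (q g) g | q. \<forall>g. q g \<in> polys n}"

lemma smul_add_left: "smul (p + q) v = smul p v + smul q v"
  by (simp add: smul_def fun_eq_iff distrib_right fun_simps)

lemma smul_add_right: "smul p (v + w) = smul p v + smul p w"
  by (simp add: smul_def fun_eq_iff distrib_left fun_simps)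

lemma smul_smul: "smul p (smul q v) = smul (p * q) v"
  by (simp add: smul_def mult.assoc)

lemma smul_0 [simp]: "smul 0 v = 0"
  by (simp add: smul_def fun_eq_iff fun_simps)

lemma smul_0_right [simp]: "smul p 0 = 0"
  by (simp add: smul_def fun_eq_iff fun_simps)

lemma smul_1 [simp]: "smul 1 v = v"
  by (simp add: smul_def)

lemma smul_sum: "smul p (sum f A) = (\<Sum>i\<in>A. smul p (f i))"
  by (induction A rule: infinite_finite_induct) (auto simp: smul_add_right)

lemma span_over_0: "0 \<in> span_over n G"
  unfolding span_over_def by (intro CollectI exI[of _ "\<lambda>_. 0"]) simp

lemma span_over_add: "v \<in> span_over n G \<Longrightarrow> w \<in> span_over n G \<Longrightarrow> v + w \<in> span_over n G"
proof -
  assume "v \<in> span_over n G" "w \<in> span_over n G"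
  then obtain q q' where "v = (\<Sum>g\<in>G. smul (q g) g)" "w = (\<Sum>g\<in>G. smul (q' g) g)"
    "\<forall>g. q g \<in> polys n" "\<forall>g. q' g \<in> polys n" by (auto simp: span_over_def)
  then show ?thesis
    unfolding span_over_def
    by (intro CollectI exI[of _ "\<lambda>g. q g + q' g"]) (auto simp: smul_add_left sum.distrib polys_add)
qed

lemma span_over_smul: "p \<in> polys n \<Longrightarrow> v \<in> span_over n G \<Longrightarrow> smul p v \<in> span_over n G"
proof -
  assume p: "p \<in> polys n" and "v \<in> span_over n G"
  then obtain q where "v = (\<Sum>g\<in>G. smul (q g) g)" "\<forall>g. q g \<in> polys n" by (auto simp: span_over_def)
  then show ?thesis
    unfolding span_over_def using p
    by (intro CollectI exI[of _ "\<lambda>g. p * q g"]) (auto simp: smul_sum smul_smul polys_mult)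
qed

lemma span_over_sum: "(\<And>i. i \<in> A \<Longrightarrow> f i \<in> span_over n G) \<Longrightarrow> sum f A \<in> span_over n G"
  by (induction A rule: infinite_finite_induct) (auto intro: span_over_0 span_over_add)

lemma span_over_incl:
  assumes "finite G" "g \<in> G"
  shows "g \<in> span_over n G"
proof -
  have "(\<Sum>h\<in>G. smul (if h = g then 1 else 0) h) = (\<Sum>h\<in>G. if h = g then g else 0)"
    by (intro sum.cong) auto
  also have "\<dots> = g" using assms by simp
  finally show ?thesis
    unfolding span_over_def
    by (intro CollectI exI[of _ "\<lambda>h. if h = g then 1 else 0"]) (auto simp: polys_def)
qed

lemma span_over_trans: "H \<subseteq> span_over n G \<Longrightarrow> span_over n H \<subseteq> span_over n G"
  by (auto simp: span_over_def[of n H] intro!: span_over_sum span_over_smul)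

definition homogeneous :: "(nat \<Rightarrow> nat) \<Rightarrow> nat \<Rightarrow> 'a::field vec \<Rightarrow> bool" where
  "homogeneous s j v \<longleftrightarrow> (\<forall>l. \<forall>m\<in>Poly_Mapping.keys (v l). mon_deg m + s l = j)"

lemma finite_monomials: "finite {m. Poly_Mapping.keys m \<subseteq> {1..n} \<and> mon_deg m \<le> j}"
proof (rule finite_subset)
  show "finite ((\<lambda>f. \<Sum>i\<in>{1..n}. Poly_Mapping.single i (f i)) ` ({1..n} \<rightarrow>\<^sub>E {..j}))"
    by (intro finite_imageI finite_PiE) auto
  show "{m. Poly_Mapping.keys m \<subseteq> {1..n} \<and> mon_deg m \<le> j} \<subseteq>
      (\<lambda>f. \<Sum>i\<in>{1..n}. Poly_Mapping.single i (f i)) ` ({1..n} \<rightarrow>\<^sub>E {..j})"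
  proof
    fix m assume "m \<in> {m. Poly_Mapping.keys m \<subseteq> {1..n} \<and> mon_deg m \<le> j}"
    then have m: "Poly_Mapping.keys m \<subseteq> {1..n}" "mon_deg m \<le> j" by auto
    have "Poly_Mapping.lookup m i \<le> mon_deg m" for i
      by (cases "i \<in> Poly_Mapping.keys m") (auto simp: mon_deg_def in_keys_iff intro!: member_le_sum)
    then have "Poly_Mapping.lookup m i \<le> j" for i
      using m(2) order_trans by blast
    then have "restrict (Poly_Mapping.lookup m) {1..n} \<in> {1..n} \<rightarrow>\<^sub>E {..j}"
      by simp
    moreover have "m = (\<Sum>i\<in>{1..n}. Poly_Mapping.single i (restrict (Poly_Mapping.lookup m) {1..n} i))"
      using m(1) by (intro poly_mapping_eqI) (auto simp: lookup_sum lookup_single when_def in_keys_iff)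
    ultimately show "m \<in> (\<lambda>f. \<Sum>i\<in>{1..n}. Poly_Mapping.single i (f i)) ` ({1..n} \<rightarrow>\<^sub>E {..j})"
      by blast
  qed
qed

text \<open>
  The degree $j$ part of $S^r$ is spanned over $K$ by finitely many terms, so a $K$-basis of $M_j$ is
  finite.
\<close>

lemma finite_span_degree:
  fixes M :: "'a::field vec set"
  assumes M: "graded_submodule n r s M"
  obtains B where "finite B" "B \<subseteq> M" "\<And>v. v \<in> B \<Longrightarrow> homogeneous s j v"
    "\<And>v. v \<in> M \<Longrightarrow> homogeneous s j v \<Longrightarrow> v \<in> span_over n B"
proof -
  define scale :: "'a \<Rightarrow> 'a vec \<Rightarrow> 'a vec" where "scale c v = smul (Poly_Mapping.single 0 c) v" for c v
  interpret vs: vector_space scale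
    by standard (auto simp: scale_def smul_add_right smul_add_left[symmetric] single_add smul_smul mult_single)
  define V where "V = {v \<in> M. homogeneous s j v}"
  define unit :: "nat \<Rightarrow> (nat \<Rightarrow>\<^sub>0 nat) \<Rightarrow> 'a vec" where "unit l m k = (if k = l then Poly_Mapping.single m 1 else 0)" for l m k
  define T where "T = (\<lambda>(l, m). unit l m) ` ({..<r} \<times> {m. Poly_Mapping.keys m \<subseteq> {1..n} \<and> mon_deg m \<le> j})"
  have "finite T" unfolding T_def by (intro finite_imageI finite_cartesian_product finite_monomials) auto
  have "V \<subseteq> vs.span T"
  proof
    fix v assume v: "v \<in> V"
    have vf: "v \<in> free_mod n r" using v submodule_free[OF M] by (auto simp: V_def)
    have e: "v = (\<Sum>l<r. \<Sum>m\<in>Poly_Mapping.keys (v l). scale (Poly_Mapping.lookup (v l) m) (unit l m))"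
    proof
      fix k
      have "(\<Sum>l<r. \<Sum>m\<in>Poly_Mapping.keys (v l). scale (Poly_Mapping.lookup (v l) m) (unit l m)) k
          = (\<Sum>l<r. if l = k then (\<Sum>m\<in>Poly_Mapping.keys (v l). Poly_Mapping.single m (Poly_Mapping.lookup (v l) m)) else 0)"
        unfolding fun_sum_apply by (intro sum.cong) (auto simp: scale_def smul_def unit_def mult_single)
      also have "\<dots> = v k"
        using vf by (auto simp: sum_monomials free_mod_def)
      finally show "v k = (\<Sum>l<r. \<Sum>m\<in>Poly_Mapping.keys (v l). scale (Poly_Mapping.lookup (v l) m) (unit l m)) k"
        by simp
    qed
    have "unit l m \<in> T" if "l < r" "m \<in> Poly_Mapping.keys (v l)" for l m
    proof -
      have "Poly_Mapping.keys m \<subseteq> {1..n}" using vf that by (auto simp: free_mod_def polys_def)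
      moreover have "mon_deg m + s l = j" using v that by (simp add: V_def homogeneous_def)
      ultimately show ?thesis unfolding T_def using that by force
    qed
    then show "v \<in> vs.span T"
      by (subst e) (intro vs.span_sum vs.span_scale vs.span_base, auto)
  qed
  obtain B where B: "B \<subseteq> V" "vs.independent B" "V \<subseteq> vs.span B"
    by (rule vs.maximal_independent_subset)
  have fin: "finite B"
    using vs.independent_span_bound[OF \<open>finite T\<close> B(2)] B(1) \<open>V \<subseteq> vs.span T\<close> by auto
  have "v \<in> span_over n B" if "v \<in> M" "homogeneous s j v" for v
  proof -
    have "v \<in> vs.span B" using that B(3) by (auto simp: V_def)
    then obtain u where "v = (\<Sum>b\<in>B. scale (u b) b)"
      using vs.span_finite[OF fin] by auto
    then show ?thesis
      unfolding span_over_def by (intro CollectI exI[of _ "\<lambda>b. Poly_Mapping.single 0 (u b)"]) (auto simp: scale_def)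
  qed
  then show thesis
    using that[of B] fin B(1) by (auto simp: V_def)
qed

lemma sum_hcomp:
  assumes "v \<in> free_mod n r"
  obtains D where "v = (\<Sum>d\<le>D. hcomp s 0 d v)"
proof -
  define D where "D = (\<Sum>l<r. \<Sum>m\<in>Poly_Mapping.keys (v l). mon_deg m + s l)"
  have le: "mon_deg m + s l \<le> D" if m: "m \<in> Poly_Mapping.keys (v l)" for m l
  proof -
    have "l < r" using assms m by (cases "l < r") (auto simp: free_mod_def)
    have "mon_deg m + s l \<le> (\<Sum>m\<in>Poly_Mapping.keys (v l). mon_deg m + s l)"
      by (rule member_le_sum[OF m]) auto
    also have "\<dots> \<le> D"
      unfolding D_def using \<open>l < r\<close> by (intro member_le_sum[of l "{..<r}" "\<lambda>l. \<Sum>m\<in>Poly_Mapping.keys (v l). mon_deg m + s l"]) auto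
    finally show ?thesis .
  qed
  have "v = (\<Sum>d\<le>D. hcomp s 0 d v)"
  proof (intro ext poly_mapping_eqI)
    fix l m
    have "Poly_Mapping.lookup ((\<Sum>d\<le>D. hcomp s 0 d v) l) m =
        (\<Sum>d\<le>D. if mon_deg m + s l = d then Poly_Mapping.lookup (v l) m else 0)"
      by (simp add: fun_sum_apply lookup_sum hcomp_def lookup_filt)
    also have "\<dots> = Poly_Mapping.lookup (v l) m"
      using le[of m l] by (auto simp: in_keys_iff)
    finally show "Poly_Mapping.lookup (v l) m = Poly_Mapping.lookup ((\<Sum>d\<le>D. hcomp s 0 d v) l) m" by simp
  qed
  then show thesis by (rule that)
qed

lemma homogeneous_hcomp: "homogeneous s d (hcomp s 0 d v)"
  by (auto simp: homogeneous_def hcomp_def keys_filt)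

text \<open>
  $H_0(M)_j = 0$ says $M_j \subseteq \mathfrak{m} M_{j-1}$, so beyond degree $N$ nothing new has
  to be generated, and the finite bases of $M_0,\dots,M_N$ generate $M$.
\<close>

lemma finitely_generated:
  assumes M: "graded_submodule n r s M" and van: "\<And>j. j > N \<Longrightarrow> koszul_zero_at n s M 0 j"
  obtains G where "finite G" "G \<subseteq> M" "\<And>g. g \<in> G \<Longrightarrow> \<exists>d. homogeneous s d g" "M \<subseteq> span_over n G"
proof -
  have "\<exists>B. finite B \<and> B \<subseteq> M \<and> (\<forall>v\<in>B. homogeneous s j v) \<and>
    (\<forall>v\<in>M. homogeneous s j v \<longrightarrow> v \<in> span_over n B)" for j
    by (rule finite_span_degree[OF M, of j]) blast
  then obtain B where B: "\<And>j. finite (B j)" "\<And>j. B j \<subseteq> M" "\<And>j v. v \<in> B j \<Longrightarrow> homogeneous s j v"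
    "\<And>j v. v \<in> M \<Longrightarrow> homogeneous s j v \<Longrightarrow> v \<in> span_over n (B j)"
    by metis
  define G where "G = (\<Union>j\<le>N. B j)"
  have finG: "finite G" using B(1) by (simp add: G_def)
  have hom: "v \<in> span_over n G" if "v \<in> M" "homogeneous s j v" for v j
    using that
  proof (induction j arbitrary: v rule: less_induct)
    case (less j)
    show ?case
    proof (cases "j \<le> N")
      case True
      then have "span_over n (B j) \<subseteq> span_over n G"
        by (intro span_over_trans subsetI span_over_incl finG) (auto simp: G_def)
      then show ?thesis using B(4) less.prems by blast
    next
      case False
      define z where "z A = (if A = {} then v else 0)" for A :: "nat set"
      have z: "koszul_chain n s M 0 j z"
        unfolding koszul_chain_def z_def using less.prems submodule_0[OF M]
        by (auto simp: homogeneous_def fun_simps)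
      then obtain w where w: "koszul_chain n s M (Suc 0) j w" "koszul n w = z"
        using van[of j] False chain_0_koszul[OF z] unfolding koszul_zero_at_def by auto
      have "v = koszul n w {}" by (simp add: w(2) z_def)
      also have "\<dots> = (\<Sum>b\<in>{1..n}. smul (Poly_Mapping.single (Poly_Mapping.single b 1) (ksign b {})) (w {b}))"
        by (simp add: fun_eq_iff koszul_def fun_sum_apply smul_def)
      also have "\<dots> \<in> span_over n G"
      proof (intro span_over_sum span_over_smul polys_single)
        fix b
        have "homogeneous s (j - 1) (w {b})"
          unfolding homogeneous_def using chain_keys(3)[OF w(1)] by fastforce
        then show "w {b} \<in> span_over n G"
          using less.IH[of "j - 1" "w {b}"] chain_mem[OF w(1)] False by simp
      qed auto
      finally show ?thesis .
    qed
  qed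
  have "v \<in> span_over n G" if v: "v \<in> M" for v
  proof -
    obtain D where D: "v = (\<Sum>d\<le>D. hcomp s 0 d v)"
      using sum_hcomp[OF submodule_free[OF M v]] .
    show ?thesis
      by (subst D) (intro span_over_sum hom[OF _ homogeneous_hcomp] submodule_hcomp[OF M] v)
  qed
  moreover have "G \<subseteq> M" "\<And>g. g \<in> G \<Longrightarrow> \<exists>d. homogeneous s d g"
    using B(2,3) unfolding G_def by blast+
  ultimately show thesis
    using that[of G] finG by blast
qed

text \<open>
  Take a homogeneous generating set of least cardinality. If a syzygy had a nonzero constant term
  in position \<open>l0\<close>, its component in the degree of the generator \<open>g l0\<close> would have a unit there and
  would express \<open>g l0\<close> by the other generators.
\<close>

lemma min_cover_exists:
  fixes M :: "'a::field vec set"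
  assumes M: "graded_submodule n r' s' M" and van: "\<And>j. j > N \<Longrightarrow> koszul_zero_at n s' M 0 j"
  obtains r s a where "min_cover n r' s' M r s a"
proof -
  define P where "P G \<longleftrightarrow> finite G \<and> G \<subseteq> M \<and> (\<forall>g\<in>G. \<exists>d. homogeneous s' d g) \<and> M \<subseteq> span_over n G" for G
  obtain G0 where "P G0"
    using finitely_generated[OF M van] unfolding P_def by metis
  then obtain G where G: "P G" and least: "\<And>H. P H \<Longrightarrow> card G \<le> card H"
    using ex_has_least_nat[of P G0 card] by blast
  define r where "r = card G"
  obtain g where g: "bij_betw g {..<r} G"
    using G ex_bij_betw_nat_finite[of G] unfolding P_def r_def by (auto simp: atLeast0LessThan)
  have gG: "g l \<in> G" if "l < r" for l using g that by (auto simp: bij_betw_def)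
  then have gM: "g l \<in> M" if "l < r" for l using that G by (auto simp: P_def)
  define s where "s l = (SOME d. homogeneous s' d (g l))" for l
  have s: "homogeneous s' (s l) (g l)" if "l < r" for l
  proof -
    have "\<exists>d. homogeneous s' d (g l)" using gG[OF that] G unfolding P_def by blast
    then show ?thesis unfolding s_def by (rule someI_ex)
  qed
  define a where "a k l = g l k" for k l
  have gm: "graded_matrix n r s r' s' a"
    using s submodule_free[OF M gM] unfolding graded_matrix_def a_def homogeneous_def free_mod_def by auto
  have lin: "linmap r r' a v = (\<Sum>l<r. smul (v l) (g l))" for v
  proof
    fix k
    show "linmap r r' a v k = (\<Sum>l<r. smul (v l) (g l)) k"
    proof (cases "k < r'")
      case True
      then show ?thesis by (simp add: linmap_def fun_sum_apply smul_def a_def mult.commute)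
    next
      case False
      then have "g l k = 0" if "l < r" for l using submodule_free[OF M gM[OF that]] by (simp add: free_mod_def)
      then show ?thesis using False by (simp add: linmap_def fun_sum_apply smul_def)
    qed
  qed
  have im: "linmap r r' a ` free_mod n r = M"
  proof (intro equalityI subsetI)
    fix v assume "v \<in> linmap r r' a ` free_mod n r"
    then show "v \<in> M"
      unfolding lin by (auto simp: free_mod_def intro!: submodule_sum[OF M] submodule_smul[OF M] gM)
  next
    fix v assume "v \<in> M"
    then obtain q where q: "v = (\<Sum>h\<in>G. smul (q h) h)" "\<forall>h. q h \<in> polys n"
      using G by (auto simp: P_def span_over_def)
    have "v = (\<Sum>l<r. smul (q (g l)) (g l))"
      unfolding q(1) by (rule sum.reindex_bij_betw[OF g, symmetric])
    then have "v = linmap r r' a (\<lambda>l. if l < r then q (g l) else 0)"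
      by (simp add: lin)
    then show "v \<in> linmap r r' a ` free_mod n r"
      using trunc_free[of "\<lambda>l. q (g l)" n r] q(2) by blast
  qed
  have "Poly_Mapping.lookup (v l0) 0 = 0" if v: "v \<in> syzygies n r r' a" for v l0
  proof (rule ccontr)
    assume c: "Poly_Mapping.lookup (v l0) 0 \<noteq> 0"
    then have l0: "l0 < r" using v by (cases "l0 < r") (auto simp: syzygies_def free_mod_def)
    define c where "c = Poly_Mapping.lookup (v l0) 0"
    define u where "u = hcomp s 0 (s l0) v"
    have u: "u \<in> syzygies n r r' a"
      unfolding u_def by (rule submodule_hcomp[OF submodule_syzygies[OF gm] v])
    have ul0: "u l0 = Poly_Mapping.single 0 c"
      by (rule poly_mapping_eqI) (auto simp: u_def hcomp_def lookup_filt mon_deg_eq_0_iff lookup_single when_def c_def)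
    have "0 = (\<Sum>l<r. smul (u l) (g l))" using u by (simp add: syzygies_def lin)
    also have "\<dots> = smul (u l0) (g l0) + (\<Sum>l\<in>{..<r} - {l0}. smul (u l) (g l))"
      using l0 by (intro sum.remove) auto
    finally have "smul (u l0) (g l0) + (\<Sum>l\<in>{..<r} - {l0}. smul (u l) (g l)) = 0" by simp
    then have "smul (Poly_Mapping.single 0 (1 / c)) (smul (u l0) (g l0) + (\<Sum>l\<in>{..<r} - {l0}. smul (u l) (g l))) = 0"
      by simp
    then have "g l0 + (\<Sum>l\<in>{..<r} - {l0}. smul (Poly_Mapping.single 0 (1 / c) * u l) (g l)) = 0"
      using c by (simp add: smul_add_right smul_sum smul_smul ul0 mult_single c_def)
    then have g0: "g l0 = smul (- 1) (\<Sum>l\<in>{..<r} - {l0}. smul (Poly_Mapping.single 0 (1 / c) * u l) (g l))"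
      by (simp add: add_eq_0_iff2 smul_def fun_Compl_def)
    define H where "H = G - {g l0}"
    have finH: "finite H" using G by (simp add: H_def P_def)
    have "g l0 \<in> span_over n H"
      unfolding g0
    proof (intro span_over_smul span_over_sum)
      show "- 1 \<in> polys n" using polys_uminus[of 1 n] by (simp add: polys_def)
      fix l assume l: "l \<in> {..<r} - {l0}"
      show "Poly_Mapping.single 0 (1 / c) * u l \<in> polys n"
        using u by (intro polys_mult) (auto simp: syzygies_def free_mod_def)
      have "g l \<noteq> g l0" using g l l0 by (auto simp: bij_betw_def inj_on_def)
      then show "g l \<in> span_over n H"
        using l gG by (intro span_over_incl finH) (auto simp: H_def)
    qed
    then have "G \<subseteq> span_over n H"
      using span_over_incl[OF finH] by (auto simp: H_def)
    then have "span_over n G \<subseteq> span_over n H" by (rule span_over_trans)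
    then have "M \<subseteq> span_over n H" using G unfolding P_def by blast
    then have "P H" using G finH unfolding P_def H_def by blast
    moreover have "card H < card G"
      unfolding H_def using G gG[OF l0] by (intro card_Diff1_less) (auto simp: P_def)
    ultimately show False using least[of H] by simp
  qed
  then have "min_cover n r' s' M r s a"
    unfolding min_cover_def using gm im by blast
  then show thesis by (rule that)
qed

text \<open>
  Iterate minimal covers. The vanishing hypothesis passes from a module to its syzygies by dimension
  shifting, so the next cover exists again.
\<close>

lemma minimal_resolution_exists:
  fixes I :: "'a::field mpoly set"
  assumes M: "graded_submodule n 1 (\<lambda>_. 0) (vec1 ` I)"
    and van: "\<And>i j. j > N \<Longrightarrow> koszul_zero_at n (\<lambda>_. 0) (vec1 ` I) i j"
  shows "\<exists>F. minimal_graded_free_resolution n I F"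
proof -
  define Q where "Q k x \<longleftrightarrow> (case x of (r, s, M) \<Rightarrow> graded_submodule n r s M \<and>
      (\<forall>i j. j > N \<longrightarrow> koszul_zero_at n s M i j) \<and>
      (k = 0 \<longrightarrow> r = 1 \<and> s = (\<lambda>_. 0) \<and> M = vec1 ` I))"
    for k :: nat and x :: "nat \<times> (nat \<Rightarrow> nat) \<times> 'a vec set"
  define R where "R x y \<longleftrightarrow> (case (x, y) of ((r, s, M), (r', s', M')) \<Rightarrow>
      (\<exists>a. min_cover n r s M r' s' a \<and> M' = syzygies n r' r a))"
    for x y :: "nat \<times> (nat \<Rightarrow> nat) \<times> 'a vec set"
  have "\<exists>f. \<forall>k. Q k (f k) \<and> R (f k) (f (Suc k))"
  proof (rule dependent_nat_choice)
    show "\<exists>x. Q 0 x" using M van by (auto simp: Q_def)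
  next
    fix x k assume Q: "Q k x"
    obtain r s M where x: "x = (r, s, M)" by (cases x)
    have 1: "graded_submodule n r s M" "\<And>i j. j > N \<Longrightarrow> koszul_zero_at n s M i j"
      using Q by (auto simp: Q_def x)
    obtain r' s' a where c: "min_cover n r s M r' s' a"
      using min_cover_exists[OF 1(1) 1(2)] by metis
    then have "graded_submodule n r' s' (syzygies n r' r a)"
      by (intro submodule_syzygies[of n r' s' r s a]) (simp add: min_cover_def)
    moreover have "koszul_zero_at n s' (syzygies n r' r a) i j" if "j > N" for i j
      using koszul_shift[OF c] 1(2)[OF that] by blast
    ultimately have "Q (Suc k) (r', s', syzygies n r' r a)" "R x (r', s', syzygies n r' r a)"
      using c by (auto simp: Q_def R_def x)
    then show "\<exists>y. Q (Suc k) y \<and> R x y" by blast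
  qed
  then obtain f where f: "\<And>k. Q k (f k)" "\<And>k. R (f k) (f (Suc k))" by blast
  define rk sh md where "rk k = fst (f k)" and "sh k = fst (snd (f k))" and "md k = snd (snd (f k))" for k
  have "\<exists>a. min_cover n (rk k) (sh k) (md k) (rk (Suc k)) (sh (Suc k)) a \<and> md (Suc k) = syzygies n (rk (Suc k)) (rk k) a" for k
    using f(2)[of k] by (auto simp: R_def rk_def sh_def md_def split: prod.splits)
  then obtain mat where "\<And>k. min_cover n (rk k) (sh k) (md k) (rk (Suc k)) (sh (Suc k)) (mat k)"
    "\<And>k. md (Suc k) = syzygies n (rk (Suc k)) (rk k) (mat k)" by metis
  then have "syzygy_tower n rk sh md mat" by (simp add: syzygy_tower_def)
  moreover have "rk 0 = 1" "sh 0 = (\<lambda>_. 0)" "md 0 = vec1 ` I"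
    using f(1)[of 0] by (auto simp: Q_def rk_def sh_def md_def split: prod.splits)
  ultimately show ?thesis by (rule tower_resolution)
qed

text \<open>
  \<open>tower_koszul\<close> applies to every minimal resolution. Existence guarantees that the resolution chosen
  in \<open>graded_betti\<close> is one.
\<close>

lemma graded_betti_koszul:
  assumes "graded_submodule n 1 (\<lambda>_. 0) (vec1 ` I)"
    and "\<And>i j. j > N \<Longrightarrow> koszul_zero_at n (\<lambda>_. 0) (vec1 ` I) i j"
  shows "graded_betti n I i j \<noteq> 0 \<longleftrightarrow> \<not> koszul_zero_at n (\<lambda>_. 0) (vec1 ` I) i j"
proof -
  define F where "F = (SOME F. minimal_graded_free_resolution n I F)"
  have "minimal_graded_free_resolution n I F"
    unfolding F_def by (rule someI_ex) (rule minimal_resolution_exists[OF assms])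
  then obtain rk sh md mat where T: "syzygy_tower n rk sh md mat" "rk 0 = 1" "sh 0 = (\<lambda>_. 0)" "md 0 = vec1 ` I"
    "\<And>i. rk (Suc i) = rank F i" "\<And>i. sh (Suc i) = shift F i"
    using resolution_tower by metis
  have "graded_betti n I i j = card {l. l < rank F i \<and> shift F i l = j}"
    by (simp add: graded_betti_def F_def Let_def)
  then have "graded_betti n I i j \<noteq> 0 \<longleftrightarrow> (\<exists>l<rank F i. shift F i l = j)"
    by auto
  then show ?thesis
    using tower_koszul[OF T(1), of 0 i j] T by simp
qed

section \<open>Monomial ideals\<close>

definition monomial_ideal :: "nat \<Rightarrow> (nat \<Rightarrow>\<^sub>0 nat) set \<Rightarrow> 'a::field mpoly set" where
  "monomial_ideal n E = {p \<in> polys n. Poly_Mapping.keys p \<subseteq> E}"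

definition monomial_vecs :: "nat \<Rightarrow> (nat \<Rightarrow>\<^sub>0 nat) set \<Rightarrow> 'a::field vec set" where
  "monomial_vecs n E = {v \<in> free_mod n 1. \<forall>l. Poly_Mapping.keys (v l) \<subseteq> E}"

definition upward_closed :: "(nat \<Rightarrow>\<^sub>0 nat) set \<Rightarrow> bool" where
  "upward_closed E \<longleftrightarrow> (\<forall>m\<in>E. \<forall>m'. m' + m \<in> E)"

lemma vec1_monomial_ideal: "vec1 ` monomial_ideal n E = monomial_vecs n E"
proof (intro equalityI subsetI)
  fix v :: "'a vec" assume "v \<in> monomial_vecs n E"
  then have "v = vec1 (v 0)" "v 0 \<in> monomial_ideal n E"
    by (auto simp: monomial_vecs_def monomial_ideal_def free_mod_def vec1_def fun_eq_iff)
  then show "v \<in> vec1 ` monomial_ideal n E" by blast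
qed (auto simp: monomial_vecs_def monomial_ideal_def free_mod_def vec1_def split: if_splits)

lemma keys_mult_upward_closed:
  assumes "upward_closed E" "Poly_Mapping.keys p \<subseteq> E"
  shows "Poly_Mapping.keys (q * p :: 'a::field mpoly) \<subseteq> E"
  using keys_mult[of q p] assms by (fastforce simp: upward_closed_def)

lemma keys_add_subset:
  "Poly_Mapping.keys p \<subseteq> E \<Longrightarrow> Poly_Mapping.keys q \<subseteq> E \<Longrightarrow> Poly_Mapping.keys (p + q) \<subseteq> E"
  using keys_add[of p q] by blast

lemma submodule_monomial:
  assumes "upward_closed E"
  shows "graded_submodule n 1 (\<lambda>_. 0) (monomial_vecs n E)"
  unfolding graded_submodule_def
proof (intro conjI ballI allI)
  note F = submodule_free_mod[of n 1 "\<lambda>_. 0"]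
  show "monomial_vecs n E \<subseteq> free_mod n 1" by (auto simp: monomial_vecs_def)
  show "0 \<in> monomial_vecs n E"
    using submodule_0[OF F] by (simp add: monomial_vecs_def fun_simps)
  fix v w :: "'a vec" assume v: "v \<in> monomial_vecs n E"
  show "v + w \<in> monomial_vecs n E" if w: "w \<in> monomial_vecs n E"
    using submodule_add[OF F, of v w] v w by (simp add: monomial_vecs_def fun_simps keys_add_subset)
  show "smul p v \<in> monomial_vecs n E" if "p \<in> polys n" for p
    using submodule_smul[OF F that, of v] v
    by (simp add: monomial_vecs_def smul_def keys_mult_upward_closed[OF assms])
  show "hcomp (\<lambda>_. 0) i j v \<in> monomial_vecs n E" for i j
    using submodule_hcomp[OF F, of v i j] v by (auto simp: monomial_vecs_def hcomp_def keys_filt)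
qed

lemma monomial_vecs_cong:
  assumes "\<And>m. Poly_Mapping.keys m \<subseteq> {1..n} \<Longrightarrow> m \<in> E \<longleftrightarrow> m \<in> E'"
  shows "monomial_vecs n E = (monomial_vecs n E' :: 'a::field vec set)"
  using assms unfolding monomial_vecs_def free_mod_def polys_def by blast

lemma keys_nonempty: "u \<noteq> 0 \<Longrightarrow> \<exists>v. v \<in> Poly_Mapping.keys (u :: nat \<Rightarrow>\<^sub>0 nat)"
  by (auto simp: poly_mapping_eq_iff fun_eq_iff in_keys_iff)

text \<open>
  The contraction stays inside a monomial ideal if for every multidegree $u$ one can choose a variable
  $x_v$ such that every term $x^{m+v} e_A$ of multidegree $u$ with $v \notin A$ and coefficient in
  the ideal still has its coefficient in the ideal after division by $x_v$.
\<close>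

lemma monomial_koszul_zero:
  assumes "0 \<notin> E"
    and sel: "\<And>u. u \<noteq> 0 \<Longrightarrow> Poly_Mapping.keys u \<subseteq> {1..n} \<Longrightarrow> \<exists>v\<in>Poly_Mapping.keys u. \<forall>A m. A \<subseteq> {1..n} \<and> card A = i \<and> v \<notin> A \<and>
      m + Poly_Mapping.single v 1 \<in> E \<and> m + Poly_Mapping.single v 1 + expo A = u \<and>
      mon_deg (m + Poly_Mapping.single v 1) + i = j \<longrightarrow> m \<in> E"
  shows "koszul_zero_at n (\<lambda>_. 0) (monomial_vecs n E :: 'a::field vec set) i j"
  unfolding koszul_zero_at_def
proof (intro allI impI, elim conjE)
  fix z :: "nat set \<Rightarrow> 'a vec"
  assume z: "koszul_chain n (\<lambda>_. 0) (monomial_vecs n E) i j z" and cyc: "koszul n z = 0"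
  define ok where "ok u v \<longleftrightarrow> (\<forall>A m. A \<subseteq> {1..n} \<and> card A = i \<and> v \<notin> A \<and>
      m + Poly_Mapping.single v 1 \<in> E \<and> m + Poly_Mapping.single v 1 + expo A = u \<and>
      mon_deg (m + Poly_Mapping.single v 1) + i = j \<longrightarrow> m \<in> E)" for u v
  have "\<exists>v. v \<in> Poly_Mapping.keys u \<and> (Poly_Mapping.keys u \<subseteq> {1..n} \<longrightarrow> ok u v)" if "u \<noteq> 0" for u
    using sel[OF that] keys_nonempty[OF that] unfolding ok_def by blast
  then obtain c where c: "\<And>u. u \<noteq> 0 \<Longrightarrow> c u \<in> Poly_Mapping.keys u"
    and c': "\<And>u. u \<noteq> 0 \<Longrightarrow> Poly_Mapping.keys u \<subseteq> {1..n} \<Longrightarrow> ok u (c u)"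
    by metis
  have zE: "Poly_Mapping.keys (z A l) \<subseteq> E" for A l
    using chain_mem[OF z, of A] by (auto simp: monomial_vecs_def)
  then have const: "Poly_Mapping.lookup (z {} l) 0 = 0" for l
    using assms(1) by (meson in_keys_iff subset_iff)
  have "monomial_vecs n E \<subseteq> (free_mod n 1 :: 'a vec set)" by (auto simp: monomial_vecs_def)
  then obtain w where w: "koszul n w = z" "koszul_chain n (\<lambda>_. 0) (free_mod n 1) (Suc i) j w"
    "\<And>A l m. m \<in> Poly_Mapping.keys (w A l) \<Longrightarrow> A \<subseteq> {1..n} \<and> c (m + expo A) \<in> A \<and>
      m + Poly_Mapping.single (c (m + expo A)) 1 \<in> Poly_Mapping.keys (z (A - {c (m + expo A)}) l)"
    by (rule contract_chain[OF z _ cyc const, where c = c]) (use c in blast)+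
  have "m \<in> E" if m: "m \<in> Poly_Mapping.keys (w A l)" for A l m
  proof -
    define v where "v = c (m + expo A)"
    have v: "A \<subseteq> {1..n}" "v \<in> A" "m + Poly_Mapping.single v 1 \<in> Poly_Mapping.keys (z (A - {v}) l)"
      using w(3)[OF m] by (auto simp: v_def)
    have fin: "finite A" using v(1) finite_subset by blast
    have "expo A = expo (A - {v}) + Poly_Mapping.single v 1"
      using expo_insert[of "A - {v}" v] fin v(2) by (simp add: insert_absorb)
    then have u: "m + Poly_Mapping.single v 1 + expo (A - {v}) = m + expo A"
      by (simp add: ac_simps)
    have "m + expo A \<noteq> 0"
      using v(2) keys_plus_nat[of m "expo A"] fin by (auto simp: keys_expo)
    moreover have "Poly_Mapping.keys m \<subseteq> {1..n}"
      using chain_mem[OF w(2), of A] m by (auto simp: free_mod_def polys_def)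
    ultimately have "ok (m + expo A) v"
      using c'[of "m + expo A"] v(1) fin by (simp add: v_def keys_plus_nat keys_expo)
    moreover have "m + Poly_Mapping.single v 1 \<in> E" using zE v(3) by blast
    moreover have "card (A - {v}) = i" "mon_deg (m + Poly_Mapping.single v 1) + i = j"
      using chain_keys[OF z v(3)] by simp_all
    ultimately show ?thesis
      unfolding ok_def using u v(1) by blast
  qed
  then have "w A \<in> monomial_vecs n E" for A
    using chain_mem[OF w(2), of A] by (auto simp: monomial_vecs_def)
  then have "koszul_chain n (\<lambda>_. 0) (monomial_vecs n E) (Suc i) j w"
    using chain_mono[OF w(2)] by blast
  then show "\<exists>w. koszul_chain n (\<lambda>_. 0) (monomial_vecs n E) (Suc i) j w \<and> koszul n w = z"
    using w(1) by blast
qed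

text \<open>
  The exponents of the monomials in the squarefree monomial ideal generated by all $x_F$, $F \in D$.
\<close>

definition supports_above :: "nat set set \<Rightarrow> (nat \<Rightarrow>\<^sub>0 nat) set" where
  "supports_above D = {m. \<exists>F\<in>D. F \<subseteq> Poly_Mapping.keys m}"

lemma upward_closed_supports_above: "upward_closed (supports_above D)"
  by (auto simp: upward_closed_def supports_above_def keys_plus_nat)

text \<open>
  A multidegree $u$ of total degree above $n$ has an exponent $u_v \ge 2$. For $v \notin A$ the coefficient
  of $e_A$ is then divisible by $x_v^2$, and dividing by $x_v$ does not change its support.
\<close>

lemma squarefree_koszul_bound:
  assumes "{} \<notin> D" "j > n"
  shows "koszul_zero_at n (\<lambda>_. 0) (monomial_vecs n (supports_above D) :: 'a::field vec set) i j"
proof (rule monomial_koszul_zero)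
  show "0 \<notin> supports_above D" using assms(1) by (auto simp: supports_above_def)
next
  fix u :: "nat \<Rightarrow>\<^sub>0 nat" assume u: "u \<noteq> 0" "Poly_Mapping.keys u \<subseteq> {1..n}"
  show "\<exists>v\<in>Poly_Mapping.keys u. \<forall>A m. A \<subseteq> {1..n} \<and> card A = i \<and> v \<notin> A \<and>
      m + Poly_Mapping.single v 1 \<in> supports_above D \<and> m + Poly_Mapping.single v 1 + expo A = u \<and>
      mon_deg (m + Poly_Mapping.single v 1) + i = j \<longrightarrow> m \<in> supports_above D"
  proof (cases "\<exists>v. Poly_Mapping.lookup u v \<ge> 2")
    case True
    then obtain v where v: "Poly_Mapping.lookup u v \<ge> 2" by blast
    show ?thesis
    proof (intro bexI[of _ v] allI impI, elim conjE)
      fix A m assume a: "A \<subseteq> {1..n}" "v \<notin> A" "m + Poly_Mapping.single v 1 \<in> supports_above D"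
        "m + Poly_Mapping.single v 1 + expo A = u"
      have "finite A" using a(1) finite_subset by blast
      then have "Poly_Mapping.lookup m v \<noteq> 0"
        using v a(2) unfolding a(4)[symmetric] by (simp add: lookup_add lookup_expo)
      then have "Poly_Mapping.keys (m + Poly_Mapping.single v 1) = Poly_Mapping.keys m"
        by (auto simp: keys_plus_nat in_keys_iff)
      then show "m \<in> supports_above D" using a(3) by (simp add: supports_above_def)
    qed (use v in \<open>auto simp: in_keys_iff\<close>)
  next
    case False
    then have le: "Poly_Mapping.lookup u k \<le> 1" for k
      by (metis One_nat_def Suc_1 not_less_eq_eq)
    have "mon_deg u \<le> card (Poly_Mapping.keys u)"
      using sum_bounded_above[of "Poly_Mapping.keys u" "Poly_Mapping.lookup u" 1] le by (simp add: mon_deg_def)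
    also have "\<dots> \<le> n" using card_mono[OF _ u(2)] by simp
    finally have "mon_deg u \<noteq> j" using assms(2) by simp
    moreover have "mon_deg (m + Poly_Mapping.single v 1 + expo A) = mon_deg (m + Poly_Mapping.single v 1) + card A"
      if "A \<subseteq> {1..n}" for A m v
      using mon_deg_expo[OF finite_subset[OF that]] by simp
    ultimately show ?thesis
      using keys_nonempty[OF u(1)] by metis
  qed
qed

text \<open>
  The exponents of the monomials in $x_1x_2(x_k : k \in V)$.
\<close>

definition pair_supports :: "nat set \<Rightarrow> (nat \<Rightarrow>\<^sub>0 nat) set" where
  "pair_supports V = supports_above ((\<lambda>k. {1,2,k}) ` V)"

lemma pair_supports_iff: "m \<in> pair_supports V \<longleftrightarrow> 1 \<in> Poly_Mapping.keys m \<and> 2 \<in> Poly_Mapping.keys m \<and> (\<exists>k\<in>V. k \<in> Poly_Mapping.keys m)"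
  by (auto simp: pair_supports_def supports_above_def)

text \<open>
  Choose the variable $x_v$ as follows. If $u$ involves a variable outside $x_1$, $x_2$ and $V$, take
  it; if $x_1^2$ or $x_2^2$ divides $x^u$, take that variable. Neither division affects membership.
  Otherwise take any $v \in V$ in the support of $u$. The coefficients have degree $j - i \ge 4$, and
  $x_1$, $x_2$ account for at most $2$ of it, so after division by $x_v$ some variable from $V$
  is left.
\<close>

lemma pair_koszul_zero:
  assumes V: "1 \<notin> V" "2 \<notin> V" and ij: "j \<ge> i + 4"
  shows "koszul_zero_at n (\<lambda>_. 0) (monomial_vecs n (pair_supports V) :: 'a::field vec set) i j"
proof (rule monomial_koszul_zero)
  show "0 \<notin> pair_supports V" by (auto simp: pair_supports_iff)
next
  fix u :: "nat \<Rightarrow>\<^sub>0 nat" assume u: "u \<noteq> 0"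
  define W where "W = {1,2} \<union> V"
  have red: "m \<in> pair_supports V" if "v \<notin> W \<or> v \<in> {1,2} \<and> 2 \<le> Poly_Mapping.lookup u v" "A \<subseteq> {1..n}" "v \<notin> A"
    "m + Poly_Mapping.single v 1 \<in> pair_supports V" "m + Poly_Mapping.single v 1 + expo A = u" for v A m
  proof (cases "v \<in> W")
    case True
    then have "2 \<le> Poly_Mapping.lookup u v" using that by blast
    moreover have "finite A" using that(2) finite_subset by blast
    ultimately have "Poly_Mapping.lookup m v \<noteq> 0"
      using that(3) unfolding that(5)[symmetric] by (simp add: lookup_add lookup_expo)
    then have "Poly_Mapping.keys (m + Poly_Mapping.single v 1) = Poly_Mapping.keys m"
      by (auto simp: keys_plus_nat in_keys_iff)
    then show ?thesis using that(4) by (simp add: pair_supports_iff)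
  next
    case False
    then show ?thesis using that(4) by (auto simp: pair_supports_iff keys_plus_nat W_def)
  qed
  show "\<exists>v\<in>Poly_Mapping.keys u. \<forall>A m. A \<subseteq> {1..n} \<and> card A = i \<and> v \<notin> A \<and>
      m + Poly_Mapping.single v 1 \<in> pair_supports V \<and> m + Poly_Mapping.single v 1 + expo A = u \<and>
      mon_deg (m + Poly_Mapping.single v 1) + i = j \<longrightarrow> m \<in> pair_supports V"
  proof (cases "\<exists>v\<in>Poly_Mapping.keys u. v \<notin> W \<or> v \<in> {1,2} \<and> 2 \<le> Poly_Mapping.lookup u v")
    case True
    then show ?thesis using red by blast
  next
    case False
    show ?thesis
    proof (cases "\<exists>v\<in>V. v \<in> Poly_Mapping.keys u")
      case True
      then obtain v where v: "v \<in> V" "v \<in> Poly_Mapping.keys u" by blast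
      show ?thesis
      proof (intro bexI[of _ v] allI impI v(2), elim conjE)
        fix A m assume a: "m + Poly_Mapping.single v 1 \<in> pair_supports V" "m + Poly_Mapping.single v 1 + expo A = u"
          "mon_deg (m + Poly_Mapping.single v 1) + i = j"
        have ne: "v \<noteq> 1" "v \<noteq> 2" using v(1) V by auto
        have k12: "1 \<in> Poly_Mapping.keys m" "2 \<in> Poly_Mapping.keys m"
          using a(1) ne by (auto simp: pair_supports_iff keys_plus_nat)
        have sub: "Poly_Mapping.keys m \<subseteq> Poly_Mapping.keys u"
          unfolding a(2)[symmetric] by (auto simp: keys_plus_nat)
        show "m \<in> pair_supports V"
        proof (rule ccontr)
          assume "m \<notin> pair_supports V"
          then have "Poly_Mapping.keys m \<subseteq> {1,2}"
            using k12 sub False by (auto simp: pair_supports_iff W_def)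
          \<comment> \<open>Then \<open>m\<close> has degree at most 2, although \<open>x^m x_v\<close> has degree at least 4.\<close>
          then have "mon_deg m \<le> (\<Sum>k\<in>{1,2}. Poly_Mapping.lookup m k)"
            unfolding mon_deg_def by (intro sum_mono2) auto
          also have "\<dots> \<le> Poly_Mapping.lookup u 1 + Poly_Mapping.lookup u 2"
            unfolding a(2)[symmetric] by (simp add: lookup_add)
          also have "\<dots> \<le> 1 + 1"
            using False k12 sub by (intro add_mono) (force simp: not_le)+
          finally show False using a(3) ij by simp
        qed
      qed
    next
      case none: False
      obtain v where v: "v \<in> Poly_Mapping.keys u" using keys_nonempty[OF u] by blast
      show ?thesis
      proof (intro bexI[of _ v] allI impI v, elim conjE)
        fix A m assume "m + Poly_Mapping.single v 1 \<in> pair_supports V" "m + Poly_Mapping.single v 1 + expo A = u"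
        then show "m \<in> pair_supports V"
          using none unfolding pair_supports_iff by (auto simp: keys_plus_nat)
      qed
    qed
  qed
qed

section \<open>The Mayer-Vietoris sequence of two monomial ideals\<close>

lemma chain_split:
  assumes w: "koszul_chain n (\<lambda>_. 0) (monomial_vecs n (E1 \<union> E2)) i j (w :: nat set \<Rightarrow> 'a::field vec)"
  obtains a b where "koszul_chain n (\<lambda>_. 0) (monomial_vecs n E1) i j a"
    "koszul_chain n (\<lambda>_. 0) (monomial_vecs n E2) i j b" "w = a + b"
proof -
  define a where "a A l = filt (\<lambda>m. m \<in> E1) (w A l)" for A l
  define b where "b A l = filt (\<lambda>m. m \<notin> E1) (w A l)" for A l
  have sum: "w = a + b"
    by (intro ext poly_mapping_eqI) (simp add: fun_simps a_def b_def lookup_filt lookup_add)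
  have wf: "w A \<in> free_mod n 1" "Poly_Mapping.keys (w A l) \<subseteq> E1 \<union> E2" for A l
    using chain_mem[OF w, of A] by (auto simp: monomial_vecs_def)
  have "a A \<in> monomial_vecs n E1" "b A \<in> monomial_vecs n E2" for A
    using wf[of A] by (auto simp: monomial_vecs_def free_mod_def a_def b_def filt_polys keys_filt)
  moreover have "Poly_Mapping.keys (a A l) \<subseteq> Poly_Mapping.keys (w A l)"
    "Poly_Mapping.keys (b A l) \<subseteq> Poly_Mapping.keys (w A l)" for A l
    by (auto simp: a_def b_def keys_filt)
  ultimately have "koszul_chain n (\<lambda>_. 0) (monomial_vecs n E1) i j a" "koszul_chain n (\<lambda>_. 0) (monomial_vecs n E2) i j b"
    using w unfolding koszul_chain_def by blast+
  with sum that show thesis by blast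
qed

lemma monomial_vecs_mono: "E \<subseteq> E' \<Longrightarrow> v \<in> monomial_vecs n E \<Longrightarrow> v \<in> monomial_vecs n E'"
  by (auto simp: monomial_vecs_def)

lemma chain_monomial_mono:
  "koszul_chain n s (monomial_vecs n E) i j z \<Longrightarrow> E \<subseteq> E' \<Longrightarrow> koszul_chain n s (monomial_vecs n E') i j z"
  using chain_mono chain_mem monomial_vecs_mono by metis

lemma chain_Int:
  assumes "koszul_chain n s (monomial_vecs n E1) i j z" "koszul_chain n s (monomial_vecs n E2) i j z"
  shows "koszul_chain n s (monomial_vecs n (E1 \<inter> E2)) i j z"
proof (rule chain_mono[OF assms(1)])
  show "z A \<in> monomial_vecs n (E1 \<inter> E2)" for A
    using chain_mem[OF assms(1), of A] chain_mem[OF assms(2), of A] by (simp add: monomial_vecs_def)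
qed

text \<open>
  The type argument names the coefficient field, which a set of exponents does not determine.
\<close>

abbreviation monomial_koszul_zero_at :: "'a::field itself \<Rightarrow> nat \<Rightarrow> (nat \<Rightarrow>\<^sub>0 nat) set \<Rightarrow> nat \<Rightarrow> nat \<Rightarrow> bool" where
  "monomial_koszul_zero_at T n E i j \<equiv> koszul_zero_at n (\<lambda>_. 0) (monomial_vecs n E :: 'a vec set) i j"

text \<open>
  Exactness of $H_i(I_1 \cap I_2) \to H_i(I_1) \oplus H_i(I_2) \to H_i(I_1 + I_2)$, used for a class
  in $H_i(I_1)$ alone: if it becomes zero in the sum, it comes from the intersection.
\<close>

lemma koszul_zero_summand:
  assumes U: "upward_closed E1" "upward_closed E2"
    and K: "monomial_koszul_zero_at TYPE('a::field) n (E1 \<inter> E2) i j"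
    and S: "monomial_koszul_zero_at TYPE('a) n (E1 \<union> E2) i j"
  shows "monomial_koszul_zero_at TYPE('a) n E1 i j"
  unfolding koszul_zero_at_def
proof (intro allI impI, elim conjE)
  fix z :: "nat set \<Rightarrow> 'a vec"
  assume z: "koszul_chain n (\<lambda>_. 0) (monomial_vecs n E1) i j z" "koszul n z = 0"
  note G1 = submodule_monomial[OF U(1), of n] and G2 = submodule_monomial[OF U(2), of n]
  obtain w where w: "koszul_chain n (\<lambda>_. 0) (monomial_vecs n (E1 \<union> E2)) (Suc i) j w" "koszul n w = z"
    using S chain_monomial_mono[OF z(1)] z(2) unfolding koszul_zero_at_def by blast
  obtain a b where ab: "koszul_chain n (\<lambda>_. 0) (monomial_vecs n E1) (Suc i) j a"
    "koszul_chain n (\<lambda>_. 0) (monomial_vecs n E2) (Suc i) j b" "w = a + b"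
    using chain_split[OF w(1)] .
  \<comment> \<open>The right hand side has values in the first ideal, the left hand side in the second.\<close>
  have e: "koszul n b = z - koszul n a"
    using w(2) by (simp add: ab(3) koszul_add algebra_simps)
  have "koszul_chain n (\<lambda>_. 0) (monomial_vecs n E1) i j (koszul n b)"
    unfolding e by (intro chain_diff[OF G1] z(1) chain_koszul[OF G1] ab(1))
  then have "koszul_chain n (\<lambda>_. 0) (monomial_vecs n (E1 \<inter> E2)) i j (koszul n b)"
    using chain_Int chain_koszul[OF G2 ab(2)] by blast
  then obtain c where c: "koszul_chain n (\<lambda>_. 0) (monomial_vecs n (E1 \<inter> E2)) (Suc i) j c" "koszul n c = koszul n b"
    using K koszul_koszul unfolding koszul_zero_at_def by metis
  have "koszul_chain n (\<lambda>_. 0) (monomial_vecs n E1) (Suc i) j (a + c)"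
    by (intro chain_add[OF G1] ab(1) chain_monomial_mono[OF c(1)]) auto
  moreover have "koszul n (a + c) = z"
    by (simp add: koszul_add c(2) e)
  ultimately show "\<exists>w. koszul_chain n (\<lambda>_. 0) (monomial_vecs n E1) (Suc i) j w \<and> koszul n w = z" by blast
qed

text \<open>
  Exactness of $H_i(I_1) \oplus H_i(I_2) \to H_i(I_1 + I_2) \to H_{i-1}(I_1 \cap I_2)$. The hypothesis
  on the intersection is stated for $i = k + 1$, because for $i = 0$ the last group is zero.
\<close>

lemma koszul_zero_sum:
  assumes U: "upward_closed E1" "upward_closed E2"
    and K: "\<And>k. i = Suc k \<Longrightarrow> monomial_koszul_zero_at TYPE('a::field) n (E1 \<inter> E2) k j"
    and H1: "monomial_koszul_zero_at TYPE('a) n E1 i j" and H2: "monomial_koszul_zero_at TYPE('a) n E2 i j"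
  shows "monomial_koszul_zero_at TYPE('a) n (E1 \<union> E2) i j"
  unfolding koszul_zero_at_def
proof (intro allI impI, elim conjE)
  fix z :: "nat set \<Rightarrow> 'a vec"
  assume z: "koszul_chain n (\<lambda>_. 0) (monomial_vecs n (E1 \<union> E2)) i j z" "koszul n z = 0"
  note G1 = submodule_monomial[OF U(1), of n] and G2 = submodule_monomial[OF U(2), of n]
  have G: "graded_submodule n 1 (\<lambda>_. 0) (monomial_vecs n (E1 \<union> E2) :: 'a vec set)"
    using U by (intro submodule_monomial) (auto simp: upward_closed_def)
  obtain a b where ab: "koszul_chain n (\<lambda>_. 0) (monomial_vecs n E1) i j a"
    "koszul_chain n (\<lambda>_. 0) (monomial_vecs n E2) i j b" "z = a + b"
    using chain_split[OF z(1)] .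
  have e: "koszul n a = - koszul n b"
    using z(2) by (simp add: ab(3) koszul_add add_eq_0_iff2)
  obtain c where c: "koszul_chain n (\<lambda>_. 0) (monomial_vecs n (E1 \<inter> E2)) i j c" "koszul n c = koszul n a"
  proof (cases i)
    case 0
    have "koszul_chain n (\<lambda>_. 0) (monomial_vecs n (E1 \<inter> E2)) i j (0 :: nat set \<Rightarrow> 'a vec)"
      using submodule_0[OF G1] submodule_0[OF G2] by (simp add: koszul_chain_def fun_simps monomial_vecs_def)
    moreover have "koszul n a = 0" using chain_0_koszul ab(1) 0 by blast
    ultimately show ?thesis using that koszul_zero by metis
  next
    case (Suc k)
    have "koszul_chain n (\<lambda>_. 0) (monomial_vecs n E1) k j (koszul n a)"
      using chain_koszul[OF G1] ab(1) Suc by blast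
    moreover have "koszul_chain n (\<lambda>_. 0) (monomial_vecs n E2) k j (koszul n a)"
      unfolding e using chain_uminus[OF G2 chain_koszul[OF G2]] ab(2) Suc by blast
    ultimately have "koszul_chain n (\<lambda>_. 0) (monomial_vecs n (E1 \<inter> E2)) k j (koszul n a)"
      by (rule chain_Int)
    then show ?thesis
      using K[OF Suc] koszul_koszul that Suc unfolding koszul_zero_at_def by metis
  qed
  have "koszul_chain n (\<lambda>_. 0) (monomial_vecs n E1) i j (a - c)"
    by (intro chain_diff[OF G1] ab(1) chain_monomial_mono[OF c(1)]) auto
  moreover have "koszul n (a - c) = 0" by (simp add: koszul_diff c(2))
  ultimately obtain x where x: "koszul_chain n (\<lambda>_. 0) (monomial_vecs n E1) (Suc i) j x" "koszul n x = a - c"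
    using H1 unfolding koszul_zero_at_def by blast
  have "koszul_chain n (\<lambda>_. 0) (monomial_vecs n E2) i j (b + c)"
    by (intro chain_add[OF G2] ab(2) chain_monomial_mono[OF c(1)]) auto
  moreover have "koszul n (b + c) = 0" by (simp add: koszul_add c(2) e)
  ultimately obtain y where y: "koszul_chain n (\<lambda>_. 0) (monomial_vecs n E2) (Suc i) j y" "koszul n y = b + c"
    using H2 unfolding koszul_zero_at_def by blast
  have "koszul_chain n (\<lambda>_. 0) (monomial_vecs n (E1 \<union> E2)) (Suc i) j (x + y)"
    by (intro chain_add[OF G] chain_monomial_mono[OF x(1)] chain_monomial_mono[OF y(1)]) auto
  moreover have "koszul n (x + y) = z"
    by (simp add: koszul_add x(2) y(2) ab(3))
  ultimately show "\<exists>w. koszul_chain n (\<lambda>_. 0) (monomial_vecs n (E1 \<union> E2)) (Suc i) j w \<and> koszul n w = z" by blast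
qed

section \<open>Squarefree ideals\<close>

lemma monomial_ideal_add:
  "p \<in> monomial_ideal n E \<Longrightarrow> q \<in> monomial_ideal n E \<Longrightarrow> p + q \<in> monomial_ideal n E"
  by (simp add: monomial_ideal_def polys_add keys_add_subset)

lemma monomial_ideal_zero: "0 \<in> monomial_ideal n E"
  by (simp add: monomial_ideal_def)

lemma monomial_ideal_sum:
  "(\<And>a. a \<in> A \<Longrightarrow> f a \<in> monomial_ideal n E) \<Longrightarrow> sum f A \<in> monomial_ideal n E"
  by (induction A rule: infinite_finite_induct) (auto intro: monomial_ideal_add monomial_ideal_zero)

lemma monomial_ideal_Un:
  "monomial_ideal n E1 + monomial_ideal n E2 = (monomial_ideal n (E1 \<union> E2) :: 'a::field mpoly set)"
proof (intro equalityI subsetI)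
  fix p :: "'a mpoly" assume p: "p \<in> monomial_ideal n (E1 \<union> E2)"
  have "p = filt (\<lambda>m. m \<in> E1) p + filt (\<lambda>m. m \<notin> E1) p"
    by (intro poly_mapping_eqI) (simp add: lookup_filt lookup_add)
  moreover have "filt (\<lambda>m. m \<in> E1) p \<in> monomial_ideal n E1" "filt (\<lambda>m. m \<notin> E1) p \<in> monomial_ideal n E2"
    using p by (auto simp: monomial_ideal_def filt_polys keys_filt)
  ultimately show "p \<in> monomial_ideal n E1 + monomial_ideal n E2"
    by (metis set_plus_intro)
next
  fix p :: "'a mpoly" assume "p \<in> monomial_ideal n E1 + monomial_ideal n E2"
  then obtain a b where "p = a + b" "a \<in> monomial_ideal n E1" "b \<in> monomial_ideal n E2"
    by (rule set_plus_elim)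
  moreover have "monomial_ideal n E1 \<subseteq> monomial_ideal n (E1 \<union> E2)" "monomial_ideal n E2 \<subseteq> monomial_ideal n (E1 \<union> E2)"
    by (auto simp: monomial_ideal_def)
  ultimately show "p \<in> monomial_ideal n (E1 \<union> E2)"
    using monomial_ideal_add by blast
qed

lemma ideal_gen_add:
  assumes "p \<in> ideal_gen n G" "q \<in> ideal_gen n G"
  shows "p + q \<in> ideal_gen n G"
proof -
  obtain A f B g where A: "finite A" "A \<subseteq> G" "\<forall>h\<in>A. f h \<in> polys n" "p = (\<Sum>h\<in>A. f h * h)"
    and B: "finite B" "B \<subseteq> G" "\<forall>h\<in>B. g h \<in> polys n" "q = (\<Sum>h\<in>B. g h * h)"
    using assms by (auto simp: ideal_gen_def)
  define k where "k h = (if h \<in> A then f h else 0) + (if h \<in> B then g h else 0)" for h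
  have "(\<Sum>h\<in>A \<union> B. (if h \<in> A then f h else 0) * h) = p"
    unfolding A(4) using A B by (intro sum.mono_neutral_cong_right) auto
  moreover have "(\<Sum>h\<in>A \<union> B. (if h \<in> B then g h else 0) * h) = q"
    unfolding B(4) using A B by (intro sum.mono_neutral_cong_right) auto
  ultimately have "p + q = (\<Sum>h\<in>A \<union> B. k h * h)"
    by (simp add: k_def distrib_right sum.distrib)
  moreover have "\<forall>h\<in>A \<union> B. k h \<in> polys n"
    using A B by (auto simp: k_def intro: polys_add)
  ultimately show ?thesis
    unfolding ideal_gen_def using A B by (intro CollectI exI[of _ "A \<union> B"] exI[of _ k]) auto
qed

lemma ideal_gen_sum:
  assumes "\<And>a. a \<in> A \<Longrightarrow> f a \<in> ideal_gen n G"
  shows "sum f A \<in> ideal_gen n G"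
proof -
  have "0 \<in> ideal_gen n G"
    unfolding ideal_gen_def by (intro CollectI exI[of _ "{}"]) simp
  then show ?thesis using assms
    by (induction A rule: infinite_finite_induct) (auto intro: ideal_gen_add)
qed

lemma ideal_gen_mult: "g \<in> G \<Longrightarrow> q \<in> polys n \<Longrightarrow> q * g \<in> ideal_gen n G"
  unfolding ideal_gen_def by (intro CollectI exI[of _ "{g}"] exI[of _ "\<lambda>_. q"]) simp

lemma prod_var: "finite F \<Longrightarrow> (\<Prod>i\<in>F. var i) = (Poly_Mapping.single (expo F) 1 :: 'a::field mpoly)"
  by (induction F rule: finite_induct)
    (auto simp: expo_insert var_def mult_single add.commute, simp add: expo_def)

text \<open>
  A polynomial lies in a monomial ideal if and only if each of its monomials does.
\<close>

lemma circuit_ideal_monomial: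
  assumes "\<And>F. F \<in> D \<Longrightarrow> F \<subseteq> {1..n}"
  shows "circuit_ideal n D = (monomial_ideal n (supports_above D) :: 'a::field mpoly set)"
proof (intro equalityI subsetI)
  have fin: "finite F" if "F \<in> D" for F using assms[OF that] finite_subset by blast
  fix p :: "'a mpoly"
  {
    assume "p \<in> circuit_ideal n D"
    then obtain A q where p: "p = (\<Sum>g\<in>A. q g * g)" "A \<subseteq> (\<lambda>F. \<Prod>i\<in>F. var i) ` D" "\<forall>g\<in>A. q g \<in> polys n"
      by (auto simp: circuit_ideal_def ideal_gen_def)
    show "p \<in> monomial_ideal n (supports_above D)"
      unfolding p(1)
    proof (rule monomial_ideal_sum)
      fix g assume g: "g \<in> A"
      then obtain F where F: "F \<in> D" "g = Poly_Mapping.single (expo F) 1"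
        using p(2) prod_var fin by (metis imageE subsetD)
      have "g \<in> polys n" "Poly_Mapping.keys g \<subseteq> supports_above D"
        using F fin[OF F(1)] assms[OF F(1)] by (auto simp: polys_def keys_expo supports_above_def)
      then show "q g * g \<in> monomial_ideal n (supports_above D)"
        using p(3) g by (simp add: monomial_ideal_def polys_mult keys_mult_upward_closed[OF upward_closed_supports_above])
    qed
  next
    assume p: "p \<in> monomial_ideal n (supports_above D)"
    have "(\<Sum>m\<in>Poly_Mapping.keys p. Poly_Mapping.single m (Poly_Mapping.lookup p m)) \<in> circuit_ideal n D"
      unfolding circuit_ideal_def
    proof (rule ideal_gen_sum)
      fix m assume m: "m \<in> Poly_Mapping.keys p"
      then obtain F where F: "F \<in> D" "F \<subseteq> Poly_Mapping.keys m"
        using p by (auto simp: monomial_ideal_def supports_above_def)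
      have "m = m - expo F + expo F"
        using F(2) fin[OF F(1)]
        by (intro poly_mapping_eqI) (auto simp: lookup_add lookup_minus lookup_expo in_keys_iff subset_iff)
      then have "Poly_Mapping.single m (Poly_Mapping.lookup p m) =
          Poly_Mapping.single (m - expo F) (Poly_Mapping.lookup p m) * (\<Prod>i\<in>F. var i)"
        by (simp add: prod_var[OF fin[OF F(1)]] mult_single)
      moreover have "Poly_Mapping.single (m - expo F) (Poly_Mapping.lookup p m) \<in> polys n"
      proof (rule polys_single)
        have "Poly_Mapping.keys (m - expo F) \<subseteq> Poly_Mapping.keys m"
          by (auto simp: in_keys_iff lookup_minus)
        then show "Poly_Mapping.keys (m - expo F) \<subseteq> {1..n}"
          using p m unfolding monomial_ideal_def polys_def by blast
      qed
      ultimately show "Poly_Mapping.single m (Poly_Mapping.lookup p m) \<in> ideal_gen n ((\<lambda>F. \<Prod>i\<in>F. var i) ` D)"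
        using ideal_gen_mult F(1) by (metis imageI)
    qed
    then show "p \<in> circuit_ideal n D" by (simp add: sum_monomials)
  }
qed

section \<open>Regularity\<close>

text \<open>
  Squarefree monomial ideals satisfy the vanishing hypothesis of \<open>graded_betti_koszul\<close> with the
  bound $n$.
\<close>

lemma circuit_ideal_betti:
  assumes "\<And>F. F \<in> D \<Longrightarrow> F \<subseteq> {1..n} \<and> card F = 3"
  shows "graded_betti n (monomial_ideal n (supports_above D) :: 'a::field mpoly set) i j \<noteq> 0 \<longleftrightarrow>
    \<not> monomial_koszul_zero_at TYPE('a) n (supports_above D) i j"
  unfolding vec1_monomial_ideal[symmetric]
proof (rule graded_betti_koszul)
  show "graded_submodule n 1 (\<lambda>_. 0) (vec1 ` monomial_ideal n (supports_above D) :: 'a vec set)"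
    unfolding vec1_monomial_ideal by (rule submodule_monomial[OF upward_closed_supports_above])
  show "koszul_zero_at n (\<lambda>_. 0) (vec1 ` monomial_ideal n (supports_above D) :: 'a vec set) i j" if "n < j" for i j
    unfolding vec1_monomial_ideal using assms that by (intro squarefree_koszul_bound) force+
qed

lemma supports_above_degree:
  assumes "\<And>F. F \<in> D \<Longrightarrow> card F = d" "m \<in> supports_above D"
  shows "d \<le> mon_deg m"
proof -
  obtain F where F: "F \<in> D" "F \<subseteq> Poly_Mapping.keys m" using assms(2) by (auto simp: supports_above_def)
  have "d \<le> card (Poly_Mapping.keys m)"
    using card_mono[OF _ F(2)] assms(1)[OF F(1)] by simp
  also have "\<dots> = (\<Sum>i\<in>Poly_Mapping.keys m. 1)" by simp
  also have "\<dots> \<le> mon_deg m"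
    unfolding mon_deg_def by (intro sum_mono) (simp add: in_keys_iff)
  finally show ?thesis .
qed

lemma koszul_zero_low_degree:
  assumes E: "\<And>m. m \<in> E \<Longrightarrow> d \<le> mon_deg m" and "j < i + d"
  shows "monomial_koszul_zero_at TYPE('a::field) n E i j"
  unfolding koszul_zero_at_def
proof (intro allI impI, elim conjE)
  fix z :: "nat set \<Rightarrow> 'a vec"
  assume z: "koszul_chain n (\<lambda>_. 0) (monomial_vecs n E) i j z"
  have "z A = 0" for A
  proof (rule ccontr)
    assume "z A \<noteq> 0"
    then obtain l m where m: "m \<in> Poly_Mapping.keys (z A l)" by (rule vec_nonzero)
    then have "m \<in> E" using chain_mem[OF z, of A] by (auto simp: monomial_vecs_def)
    then show False using E[of m] chain_keys(3)[OF z m] assms(2) by simp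
  qed
  then have z0: "z = 0" by (simp add: fun_eq_iff[of z] fun_simps)
  have "koszul_chain n (\<lambda>_. 0) (monomial_vecs n E) (Suc i) j z"
    using chain_mem[OF z] unfolding koszul_chain_def z0 by (simp add: fun_simps)
  then show "\<exists>w. koszul_chain n (\<lambda>_. 0) (monomial_vecs n E) (Suc i) j w \<and> koszul n w = z"
    using koszul_zero z0 by blast
qed

text \<open>
  A monomial of least degree in the ideal is not in $\mathfrak{m}$ times the ideal.
\<close>

lemma koszul_nonzero_generator:
  assumes E: "\<And>m. m \<in> E \<Longrightarrow> mon_deg e \<le> mon_deg m" and e: "e \<in> E" "Poly_Mapping.keys e \<subseteq> {1..n}"
  shows "\<not> monomial_koszul_zero_at TYPE('a::field) n E 0 (mon_deg e)"
proof
  assume H: "monomial_koszul_zero_at TYPE('a) n E 0 (mon_deg e)"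
  define z :: "nat set \<Rightarrow> 'a vec" where "z A = (if A = {} then vec1 (Poly_Mapping.single e 1) else 0)" for A
  have z: "koszul_chain n (\<lambda>_. 0) (monomial_vecs n E) 0 (mon_deg e) z"
    using e by (auto simp: koszul_chain_def z_def monomial_vecs_def free_mod_def vec1_def polys_def fun_simps
        split: if_splits)
  then obtain w where w: "koszul_chain n (\<lambda>_. 0) (monomial_vecs n E) (Suc 0) (mon_deg e) w" "koszul n w = z"
    using H chain_0_koszul[OF z] unfolding koszul_zero_at_def by blast
  have "e \<in> Poly_Mapping.keys (koszul n w {} 0)"
    by (simp add: w(2) z_def vec1_def)
  then obtain b where m: "e - Poly_Mapping.single b 1 \<in> Poly_Mapping.keys (w {b} 0)"
    by (rule keys_koszul)
  then have "e - Poly_Mapping.single b 1 \<in> E"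
    using chain_mem[OF w(1), of "{b}"] by (auto simp: monomial_vecs_def)
  then show False
    using E chain_keys(3)[OF w(1) m] by force
qed

text \<open>
  Below $d$ there are no differences $j - i$, the difference $d$ occurs for both ideals already at
  $i = 0$, and above $d$ the two Betti tables have the same support.
\<close>

lemma regularity_eqI:
  fixes I J :: "'a::field mpoly set"
  assumes low: "\<And>i j. graded_betti n I i j \<noteq> 0 \<Longrightarrow> i + d \<le> j" "\<And>i j. graded_betti n J i j \<noteq> 0 \<Longrightarrow> i + d \<le> j"
    and base: "graded_betti n I 0 d \<noteq> 0" "graded_betti n J 0 d \<noteq> 0"
    and high: "\<And>i j. i + d < j \<Longrightarrow> graded_betti n I i j \<noteq> 0 \<longleftrightarrow> graded_betti n J i j \<noteq> 0"
  shows "regularity n I = regularity n J"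
proof -
  have sub: "{ereal (real j - real i) | i j. graded_betti n I i j \<noteq> 0} \<subseteq> {ereal (real j - real i) | i j. graded_betti n J i j \<noteq> 0}"
    if low: "\<And>i j. graded_betti n I i j \<noteq> 0 \<Longrightarrow> i + d \<le> j"
      and base: "graded_betti n J 0 d \<noteq> 0"
      and high: "\<And>i j. i + d < j \<Longrightarrow> graded_betti n I i j \<noteq> 0 \<longleftrightarrow> graded_betti n J i j \<noteq> 0"
    for I J :: "'a mpoly set"
  proof
    fix x assume "x \<in> {ereal (real j - real i) | i j. graded_betti n I i j \<noteq> 0}"
    then obtain i j where x: "x = ereal (real j - real i)" "graded_betti n I i j \<noteq> 0" by blast
    show "x \<in> {ereal (real j - real i) | i j. graded_betti n J i j \<noteq> 0}"
    proof (cases "i + d = j")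
      case True
      then have "x = ereal (real d - real 0)" using x(1) by auto
      then show ?thesis using base by blast
    next
      case False
      then have "i + d < j" using low[OF x(2)] by simp
      then show ?thesis using high x by blast
    qed
  qed
  have "{ereal (real j - real i) | i j. graded_betti n I i j \<noteq> 0} = {ereal (real j - real i) | i j. graded_betti n J i j \<noteq> 0}"
  proof (rule equalityI)
    show "{ereal (real j - real i) | i j. graded_betti n I i j \<noteq> 0} \<subseteq> {ereal (real j - real i) | i j. graded_betti n J i j \<noteq> 0}"
      by (rule sub) (use low(1) base(2) high in blast)+
    show "{ereal (real j - real i) | i j. graded_betti n J i j \<noteq> 0} \<subseteq> {ereal (real j - real i) | i j. graded_betti n I i j \<noteq> 0}"
      by (rule sub) (use low(2) base(1) high in blast)+
  qed
  then show ?thesis by (simp only: regularity_def)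
qed

theorem theorem3p9:
  fixes n :: nat and C :: "nat set set" and I J :: "'a::field mpoly set"
  assumes "n \<ge> 4"
    and "C \<subseteq> full_clutter n 3" and "C \<noteq> full_clutter n 3"
    and "I = circuit_ideal n (clutter_complement n 3 C)"
    and "{1,2,3} \<in> C" and "{1,2,4} \<in> C" and "{1,3,4} \<in> C" and "{2,3,4} \<in> C"
    and "\<forall>F\<in>C. {1,2} \<subseteq> F \<longrightarrow> F = {1,2,3} \<or> F = {1,2,4}"
    and "J = I + ideal_gen n {var 1 * var 2 * var 3, var 1 * var 2 * var 4}"
  shows "regularity n I = regularity n J"
proof -
  define D where "D = clutter_complement n 3 C"
  define D' where "D' = insert {1,2,3} (insert {1,2,4} D)"
  \<comment> \<open>The exponents of the monomials in \<open>J' = x_1 x_2 (x_3, ..., x_n)\<close>.\<close>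
  define P where "P = pair_supports {3..n}"
  have D: "F \<subseteq> {1..n} \<and> card F = 3" if "F \<in> D" for F
    using that by (auto simp: D_def clutter_complement_def full_clutter_def)
  have D': "F \<subseteq> {1..n} \<and> card F = 3" if "F \<in> D'" for F
    using that D assms(1) by (auto simp: D'_def)
  obtain F0 where F0: "F0 \<in> D"
    using assms(2,3) by (auto simp: D_def clutter_complement_def)
  have I: "I = monomial_ideal n (supports_above D)"
    unfolding assms(4) D_def[symmetric] using D by (intro circuit_ideal_monomial) blast
  have J: "J = monomial_ideal n (supports_above D')"
  proof -
    have "ideal_gen n {var 1 * var 2 * var 3, var 1 * var 2 * var 4} = (circuit_ideal n {{1,2,3},{1,2,4}} :: 'a mpoly set)"
      by (simp add: circuit_ideal_def mult.assoc)
    also have "\<dots> = monomial_ideal n (supports_above {{1,2,3},{1,2,4}})"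
      using assms(1) by (intro circuit_ideal_monomial) auto
    also have "I + \<dots> = monomial_ideal n (supports_above D \<union> supports_above {{1,2,3},{1,2,4}})"
      unfolding I by (rule monomial_ideal_Un)
    also have "supports_above D \<union> supports_above {{1,2,3},{1,2,4}} = supports_above D'"
      by (auto simp: supports_above_def D'_def)
    finally show ?thesis using assms(10) by simp
  qed
  have pairD: "{1,2,k} \<in> D" if "k \<in> {5..n}" for k
  proof -
    have "k \<notin> {1,2,3}" "k \<notin> {1,2,4}" using that by auto
    then have "{1,2,k} \<noteq> {1,2,3}" "{1,2,k} \<noteq> {1,2,4}" by blast+
    moreover have "{1,2,k} \<in> C \<longrightarrow> {1,2,k} = {1,2,3} \<or> {1,2,k} = {1,2,4}"
      using bspec[OF assms(9), of "{1,2,k}"] by simp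
    ultimately have "{1,2,k} \<notin> C" by metis
    then show ?thesis using that by (auto simp: D_def clutter_complement_def full_clutter_def)
  qed
  have outside: "\<exists>k\<in>F. k \<in> {5..n}" if F: "F \<in> D" for F
  proof (rule ccontr)
    assume "\<not> (\<exists>k\<in>F. k \<in> {5..n})"
    then have sub: "F \<subseteq> {1,2,3,4}" using D[OF F] by force
    have "card ({1,2,3,4} - F) = 1"
      using D[OF F] sub by (subst card_Diff_subset) (auto intro: finite_subset)
    then obtain x where x: "{1,2,3,4} - F = {x}" using card_1_singletonE by blast
    then have "F = {1,2,3,4} - {x}" "x = 1 \<or> x = 2 \<or> x = 3 \<or> x = 4" using sub by blast+
    moreover have "{1,2,3,4} - {1} = {2,3,4::nat}" "{1,2,3,4} - {2} = {1,3,4::nat}"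
      "{1,2,3,4} - {3} = {1,2,4::nat}" "{1,2,3,4} - {4} = {1,2,3::nat}" by auto
    ultimately have "F \<in> C" using assms(5-8) by metis
    then show False using F by (simp add: D_def clutter_complement_def)
  qed
  have U: "upward_closed (supports_above D)" "upward_closed P"
    by (simp_all add: upward_closed_supports_above P_def pair_supports_def)
  \<comment> \<open>\<open>J = I + J'\<close>.\<close>
  have sum: "monomial_vecs n (supports_above D') = (monomial_vecs n (supports_above D \<union> P) :: 'a vec set)"
  proof (rule monomial_vecs_cong)
    fix m :: "nat \<Rightarrow>\<^sub>0 nat" assume "Poly_Mapping.keys m \<subseteq> {1..n}"
    have "m \<in> supports_above D" if m: "m \<in> P" "3 \<notin> Poly_Mapping.keys m" "4 \<notin> Poly_Mapping.keys m"
    proof -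
      obtain k where k: "k \<in> {3..n}" "{1,2,k} \<subseteq> Poly_Mapping.keys m"
        using m(1) by (auto simp: P_def pair_supports_iff)
      then have "k \<noteq> 3" "k \<noteq> 4" using m(2,3) by auto
      then have "k \<in> {5..n}" using k(1) by auto
      then show ?thesis using pairD k(2) unfolding supports_above_def by blast
    qed
    then show "m \<in> supports_above D' \<longleftrightarrow> m \<in> supports_above D \<union> P"
      using assms(1) by (auto simp: supports_above_def D'_def P_def pair_supports_iff)
  qed
  \<comment> \<open>\<open>I \<inter> J'\<close> is generated by the \<open>x_1 x_2 x_k\<close> with \<open>k \<ge> 5\<close>.\<close>
  have int: "monomial_vecs n (supports_above D \<inter> P) = (monomial_vecs n (pair_supports {5..n}) :: 'a vec set)"
  proof (rule monomial_vecs_cong)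
    fix m :: "nat \<Rightarrow>\<^sub>0 nat" assume "Poly_Mapping.keys m \<subseteq> {1..n}"
    show "m \<in> supports_above D \<inter> P \<longleftrightarrow> m \<in> pair_supports {5..n}"
    proof
      assume m: "m \<in> supports_above D \<inter> P"
      then obtain F where "F \<in> D" "F \<subseteq> Poly_Mapping.keys m" by (auto simp: supports_above_def)
      then obtain k where "k \<in> {5..n}" "k \<in> Poly_Mapping.keys m" using outside by blast
      then show "m \<in> pair_supports {5..n}" using m by (auto simp: P_def pair_supports_iff)
    next
      assume m: "m \<in> pair_supports {5..n}"
      then obtain k where k: "k \<in> {5..n}" "{1,2,k} \<subseteq> Poly_Mapping.keys m"
        by (auto simp: pair_supports_iff)
      then have "m \<in> supports_above D" using pairD unfolding supports_above_def by blast
      moreover have "m \<in> P" using k by (auto simp: P_def pair_supports_iff)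
      ultimately show "m \<in> supports_above D \<inter> P" by blast
    qed
  qed
  have K: "monomial_koszul_zero_at TYPE('a) n (supports_above D \<inter> P) i j" if "i + 4 \<le> j" for i j
    unfolding int using that by (intro pair_koszul_zero) auto
  have eq: "monomial_koszul_zero_at TYPE('a) n (supports_above D) i j \<longleftrightarrow>
      monomial_koszul_zero_at TYPE('a) n (supports_above D') i j" if ij: "i + 4 \<le> j" for i j
  proof
    assume "monomial_koszul_zero_at TYPE('a) n (supports_above D) i j"
    then show "monomial_koszul_zero_at TYPE('a) n (supports_above D') i j"
      unfolding sum using ij
      by (intro koszul_zero_sum[OF U] K) (auto simp: P_def intro!: pair_koszul_zero)
  next
    assume "monomial_koszul_zero_at TYPE('a) n (supports_above D') i j"
    then show "monomial_koszul_zero_at TYPE('a) n (supports_above D) i j"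
      unfolding sum using koszul_zero_summand[OF U K[OF ij]] by blast
  qed
  have betti_I: "graded_betti n I i j \<noteq> 0 \<longleftrightarrow> \<not> monomial_koszul_zero_at TYPE('a) n (supports_above D) i j" for i j
    unfolding I using D by (rule circuit_ideal_betti)
  have betti_J: "graded_betti n J i j \<noteq> 0 \<longleftrightarrow> \<not> monomial_koszul_zero_at TYPE('a) n (supports_above D') i j" for i j
    unfolding J using D' by (rule circuit_ideal_betti)
  have degD: "3 \<le> mon_deg m" if "m \<in> supports_above D" for m
    using supports_above_degree[of D 3 m] D that by blast
  have degD': "3 \<le> mon_deg m" if "m \<in> supports_above D'" for m
    using supports_above_degree[of D' 3 m] D' that by blast
  have fin: "finite F0" using D[OF F0] finite_subset by blast
  have e: "mon_deg (expo F0) = 3" "Poly_Mapping.keys (expo F0) \<subseteq> {1..n}"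
    using D[OF F0] mon_deg_expo[OF fin] keys_expo[OF fin] by auto
  have e': "expo F0 \<in> supports_above D" "expo F0 \<in> supports_above D'"
    using F0 keys_expo[OF fin] by (auto simp: supports_above_def D'_def)
  show ?thesis
  proof (rule regularity_eqI)
    show "i + 3 \<le> j" if "graded_betti n I i j \<noteq> 0" for i j
    proof (rule ccontr)
      assume "\<not> i + 3 \<le> j"
      then have "monomial_koszul_zero_at TYPE('a) n (supports_above D) i j"
        by (intro koszul_zero_low_degree[where d = 3] degD) auto
      then show False using that betti_I by blast
    qed
    show "i + 3 \<le> j" if "graded_betti n J i j \<noteq> 0" for i j
    proof (rule ccontr)
      assume "\<not> i + 3 \<le> j"
      then have "monomial_koszul_zero_at TYPE('a) n (supports_above D') i j"
        by (intro koszul_zero_low_degree[where d = 3] degD') auto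
      then show False using that betti_J by blast
    qed
    show "graded_betti n I 0 3 \<noteq> 0"
      unfolding betti_I using koszul_nonzero_generator[of "supports_above D" "expo F0" n] degD e e' by simp
    show "graded_betti n J 0 3 \<noteq> 0"
      unfolding betti_J using koszul_nonzero_generator[of "supports_above D'" "expo F0" n] degD' e e' by simp
    show "graded_betti n I i j \<noteq> 0 \<longleftrightarrow> graded_betti n J i j \<noteq> 0" if "i + 3 < j" for i j
      unfolding betti_I betti_J using eq[of i j] that by simp
  qed
qed

end
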